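(* Let $\Theta=\operatorname{supp}u$ be a finite set, let $\nu$ have a probability density $\rho\in L^\infty(\mathbb{R})$, and let $u(k)>0$ for all $k\in\partial^{\rm i}\Theta$. Let $\Gamma\subset\mathbb{Z}^d$ and $s\in(0,1/3)$. Then for sufficiently large $\lambda$ there are constants $\mu,A\in(0,\infty)$, depending only on $d,\rho,u,s$ and $\lambda$, such that for all $z\in\mathbb{C}\setminus\mathbb{R}$ and all $x,y\in\Gamma$ $$\mathbb{E}\bigl(|G_\Gamma(z;x,y)|^{s/(2|\Theta|)}\bigr)\le A\,e^{-\mu|x-y|_\infty}.$$
   Context: Discrete alloy-type model: $d\ge1$; $|\cdot|_1,|\cdot|_\infty$ are the $\ell^1$- and sup-norms on $\mathbb{Z}^d$. $\nu$ is a probability measure on $\mathbb{R}$ with compact support; $\Omega=\times_{k\in\mathbb{Z}^d}\mathbb{R}$ carries the product $\sigma$-algebra and $\mathbb{P}=\prod_{k}\nu$, so the coordinates $\omega_k$ are i.i.d. with law $\nu$; $\mathbb{E}$ is expectation. $u\in\ell^1(\mathbb{Z}^d;\mathbb{R})$ is the single-site potential, $\Theta=\operatorname{supp}u=\{k:u(k)\ne0\}$, and $0\in\Theta$. For $\lambda>0$, $H_\omega=-\Delta+\lambda V_\omega$ on $\ell^2(\mathbb{Z}^d)$, with $(\Delta\psi)(x)=\sum_{|e|_1=1}\psi(x+e)$ and $V_\omega$ multiplication by $V_\omega(x)=\sum_{k}\omega_k u(x-k)$. For $\Gamma\subset\mathbb{Z}^d$, $H_\Gamma$ is the compression of $H_\omega$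 to $\ell^2(\Gamma)$ (matrix elements $\langle\delta_x,H_\omega\delta_y\rangle$, $x,y\in\Gamma$; it depends on $\omega$), and $G_\Gamma(z;x,y)=\langle\delta_x,(H_\Gamma-z)^{-1}\delta_y\rangle$. Interior boundary: $\partial^{\rm i}\Theta=\{k\in\Theta: |\{j\in\Theta:|k-j|_1=1\}|<2d\}$. *)

theory Defs
  imports "HOL-Probability.Probability"
begin

definition norm_one :: "int ^ 'd \<Rightarrow> int" where
  "norm_one x = (\<Sum>i\<in>UNIV. \<bar>x $ i\<bar>)"

definition norm_max :: "int ^ 'd \<Rightarrow> int" where
  "norm_max x = Max (range (\<lambda>i. \<bar>x $ i\<bar>))"

lemma finite_norm_one_sphere: "finite {e :: int ^ 'd. norm_one e = 1}"
proof -
  have "e $ i \<in> {-1..1}" if "norm_one e = 1" for e :: "int ^ 'd" and i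
    using member_le_sum[of i UNIV "\<lambda>i. \<bar>e $ i\<bar>"] that by (auto simp: norm_one_def)
  then have "vec_nth ` {e :: int ^ 'd. norm_one e = 1} \<subseteq> UNIV \<rightarrow>\<^sub>E {-1..1}"
    by auto
  moreover have "finite ((UNIV :: 'd set) \<rightarrow>\<^sub>E {-1..1::int})"
    by (intro finite_PiE) auto
  moreover have "inj_on vec_nth {e :: int ^ 'd. norm_one e = 1}"
    by (simp add: inj_on_def vec_nth_inject)
  ultimately show ?thesis
    by (meson finite_imageD finite_subset)
qed

definition measure_support :: "real measure \<Rightarrow> real set" where
  "measure_support \<nu> = {t. \<forall>U. open U \<longrightarrow> t \<in> U \<longrightarrow> emeasure \<nu> U > 0}"

definition supp :: "(int ^ 'd \<Rightarrow> real) \<Rightarrow> (int ^ 'd) set" where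
  "supp u = {k. u k \<noteq> 0}"

definition interior_boundary :: "(int ^ 'd) set \<Rightarrow> (int ^ 'd) set" where
  "interior_boundary \<Theta> = {k \<in> \<Theta>. card {j \<in> \<Theta>. norm_one (k - j) = 1} < 2 * CARD('d)}"

(* l2(\<Gamma>), realised inside l2(Z^d) through extension by zero. *)
definition ell2 :: "(int ^ 'd) set \<Rightarrow> (int ^ 'd \<Rightarrow> complex) set" where
  "ell2 \<Gamma> = {\<psi>. (\<forall>x. x \<notin> \<Gamma> \<longrightarrow> \<psi> x = 0) \<and> (\<lambda>x. (cmod (\<psi> x))\<^sup>2) summable_on UNIV}"

definition ell2_inner :: "(int ^ 'd \<Rightarrow> complex) \<Rightarrow> (int ^ 'd \<Rightarrow> complex) \<Rightarrow> complex" where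
  "ell2_inner \<phi> \<psi> = (\<Sum>\<^sub>\<infinity>k. cnj (\<phi> k) * \<psi> k)"

definition delta :: "int ^ 'd \<Rightarrow> int ^ 'd \<Rightarrow> complex" where
  "delta x = (\<lambda>k. if k = x then 1 else 0)"

definition laplacian :: "(int ^ 'd \<Rightarrow> complex) \<Rightarrow> int ^ 'd \<Rightarrow> complex" where
  "laplacian \<psi> x = (\<Sum>e | norm_one e = 1. \<psi> (x + e))"

definition alloy_potential :: "(int ^ 'd \<Rightarrow> real) \<Rightarrow> (int ^ 'd \<Rightarrow> real) \<Rightarrow> int ^ 'd \<Rightarrow> real" where
  "alloy_potential u \<omega> x = (\<Sum>\<^sub>\<infinity>k. \<omega> k * u (x - k))"

definition hamiltonian ::
  "real \<Rightarrow> (int ^ 'd \<Rightarrow> real) \<Rightarrow> (int ^ 'd \<Rightarrow> real) \<Rightarrow> (int ^ 'd \<Rightarrow> complex) \<Rightarrow> int ^ 'd \<Rightarrow> complex" where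
  "hamiltonian g u \<omega> \<psi> x = - laplacian \<psi> x + of_real (g * alloy_potential u \<omega> x) * \<psi> x"

(* Acts on functions vanishing outside \<Gamma>, such as the elements of ell2 \<Gamma>. *)
definition compression ::
  "(int ^ 'd) set \<Rightarrow> ((int ^ 'd \<Rightarrow> complex) \<Rightarrow> int ^ 'd \<Rightarrow> complex) \<Rightarrow>
    (int ^ 'd \<Rightarrow> complex) \<Rightarrow> int ^ 'd \<Rightarrow> complex" where
  "compression \<Gamma> T \<psi> x = (if x \<in> \<Gamma> then T \<psi> x else 0)"

(* The inverse of T - z on ell2 \<Gamma>. If T is unbounded, its domain is the maximal one,
   consisting of the \<psi> in ell2 \<Gamma> with T \<psi> in ell2 \<Gamma>: for \<phi> in ell2 \<Gamma> any solution \<psi> in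
   ell2 \<Gamma> of T \<psi> - z \<psi> = \<phi> lies in it. *)
definition resolvent ::
  "(int ^ 'd) set \<Rightarrow> ((int ^ 'd \<Rightarrow> complex) \<Rightarrow> int ^ 'd \<Rightarrow> complex) \<Rightarrow> complex \<Rightarrow>
    (int ^ 'd \<Rightarrow> complex) \<Rightarrow> int ^ 'd \<Rightarrow> complex" where
  "resolvent \<Gamma> T z = inv_into (ell2 \<Gamma>) (\<lambda>\<psi> x. T \<psi> x - z * \<psi> x)"

definition green ::
  "real \<Rightarrow> (int ^ 'd \<Rightarrow> real) \<Rightarrow> (int ^ 'd \<Rightarrow> real) \<Rightarrow> (int ^ 'd) set \<Rightarrow> complex \<Rightarrow>
    int ^ 'd \<Rightarrow> int ^ 'd \<Rightarrow> complex" where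
  "green g u \<omega> \<Gamma> z x y =
    ell2_inner (delta x) (resolvent \<Gamma> (compression \<Gamma> (hamiltonian g u \<omega>)) z (delta y))"

end

theory Submission
  imports Defs
    "HOL-Computational_Algebra.Fundamental_Theorem_Algebra"
    "HOL-Complex_Analysis.Great_Picard"
    "Jordan_Normal_Form.Determinant"
begin

text \<open>
  One variable \<open>\<omega> k\<close> is averaged at a time; it acts on the block \<open>k + supp u\<close>. As a function of
  \<open>r = \<omega> k\<close> an entry of the resolvent of a finite restriction is a quotient \<open>p r / q r\<close> of
  polynomials of degree at most \<open>card (supp u)\<close>. Let \<open>z\<close> be \<open>O(g)\<close> (larger energies are off the
  spectrum). For complex \<open>r\<close> far from the real axis, on the side where \<open>r * u\<close> and \<open>- z\<close> have
  imaginary parts of the same sign on the boundary of the block, this entry is at most \<open>1 / g\<close>: if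
  the solution is largest at an interior site, the large diagonal entry there controls it, and if
  it is largest at a boundary site, the imaginary part of the quadratic form does, because
  \<open>u > 0\<close> there and all other sites outside the interior contribute with the same sign. Lagrange
  interpolation of \<open>p\<close> at \<open>card (supp u) + 1\<close> such points carries the bound to real \<open>r\<close>, at the
  price of singular factors \<open>1 + L / cmod (r - b)\<close>, one for each zero \<open>b\<close> of \<open>q\<close>. Hence the
  conditional moment of order \<open>\<tau> < 1 / card (supp u)\<close> is \<open>O(g powr - \<tau>)\<close>, uniformly in \<open>z\<close>, in
  the volume and in the other variables.

  Removing the block of \<open>x\<close> from the volume leaves a Green function that does not depend on \<open>\<omega> x\<close>, so
  each use of the resolvent expansion gains a factor \<open>O(g powr - \<tau>)\<close> per bounded distance, which
  gives exponential decay in finite volumes. Infinite volumes follow by Fatou's lemma.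
\<close>

section \<open>Determinants and adjugates over finite index sets\<close>

text \<open>Lattice sites are not numbered, so a kernel on a finite set is turned into a matrix
  through the enumeration \<open>from_nat_into S\<close>. Entries are read back with its inverse
  \<open>to_nat_on S\<close>.\<close>

definition kmat :: "'a set \<Rightarrow> ('a \<Rightarrow> 'a \<Rightarrow> 'b) \<Rightarrow> 'b Matrix.mat" where
  "kmat S A = Matrix.mat (card S) (card S) (\<lambda>(i, j). A (from_nat_into S i) (from_nat_into S j))"

definition kdet :: "'a set \<Rightarrow> ('a \<Rightarrow> 'a \<Rightarrow> 'b::comm_ring_1) \<Rightarrow> 'b" where
  "kdet S A = Determinant.det (kmat S A)"

definition kadj :: "'a set \<Rightarrow> ('a \<Rightarrow> 'a \<Rightarrow> 'b::comm_ring_1) \<Rightarrow> 'a \<Rightarrow> 'a \<Rightarrow> 'b" where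
  "kadj S A x y = adj_mat (kmat S A) $$ (to_nat_on S x, to_nat_on S y)"

lemma kmat_carrier [simp]: "kmat S A \<in> carrier_mat (card S) (card S)"
  by (simp add: kmat_def)

lemma bij_from_nat_into:
  assumes "finite S"
  shows "bij_betw (from_nat_into S) {..<card S} S"
  using bij_betw_from_nat_into_finite[OF assms] by (simp add: lessThan_def)

lemma to_nat_on_less:
  assumes "finite S" "x \<in> S"
  shows "to_nat_on S x < card S"
  using bij_betwE[OF to_nat_on_finite[OF assms(1)]] assms(2) by auto

lemma from_to_nat_on:
  assumes "finite S" "x \<in> S"
  shows "from_nat_into S (to_nat_on S x) = x"
  using assms by (simp add: countable_finite)

lemma to_from_nat_on:
  assumes S: "finite S" and j: "j < card S"
  shows "to_nat_on S (from_nat_into S j) = j"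
proof -
  have "j \<in> to_nat_on S ` S"
    using bij_betw_imp_surj_on[OF to_nat_on_finite[OF S]] j by auto
  then show ?thesis
    by (simp add: to_nat_on_from_nat_into)
qed

text \<open>This is the matrix times its adjugate. It holds over any commutative ring, so it can be
  used for kernels with polynomial entries before a parameter is inserted.\<close>

lemma kadj_right:
  fixes A :: "'a \<Rightarrow> 'a \<Rightarrow> 'b::comm_ring_1"
  assumes S: "finite S" and x: "x \<in> S" and y: "y \<in> S"
  shows "(\<Sum>w\<in>S. A x w * kadj S A w y) = of_bool (x = y) * kdet S A"
proof -
  let ?n = "card S" and ?M = "kmat S A" and ?i = "to_nat_on S x" and ?k = "to_nat_on S y"
  have i: "?i < ?n" and k: "?k < ?n"
    using to_nat_on_less[OF S] x y by auto
  have inj: "?i = ?k \<longleftrightarrow> x = y"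
    using from_to_nat_on[OF S] x y by metis
  have adj: "adj_mat ?M \<in> carrier_mat ?n ?n"
    by (rule adj_mat) simp
  have "(?M * adj_mat ?M) $$ (?i, ?k) = (\<Sum>j<?n. ?M $$ (?i, j) * adj_mat ?M $$ (j, ?k))"
    using i k adj by (simp add: times_mat_def scalar_prod_def atLeast0LessThan kmat_def)
  also have "\<dots> = (\<Sum>j<?n. A x (from_nat_into S j) * kadj S A (from_nat_into S j) y)"
    using i by (intro sum.cong) (auto simp: kmat_def kadj_def to_from_nat_on[OF S] from_to_nat_on[OF S x])
  also have "\<dots> = (\<Sum>w\<in>S. A x w * kadj S A w y)"
    by (rule sum.reindex_bij_betw[OF bij_from_nat_into[OF S]])
  finally show ?thesis
    using adj_mat(2)[of ?M ?n] i k inj by (cases "x = y") (simp_all add: kdet_def)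
qed

text \<open>A singular matrix over a field has a nonzero kernel vector; read on \<open>S\<close>, it
  would be a nontrivial solution of the homogeneous system.\<close>

lemma kdet_nonzero:
  fixes A :: "'a \<Rightarrow> 'a \<Rightarrow> 'b::field"
  assumes S: "finite S"
    and inj: "\<And>\<phi>. (\<And>x. x \<in> S \<Longrightarrow> (\<Sum>w\<in>S. A x w * \<phi> w) = 0) \<Longrightarrow> \<forall>x\<in>S. \<phi> x = 0"
  shows "kdet S A \<noteq> 0"
proof
  let ?n = "card S"
  assume "kdet S A = 0"
  then obtain v where v: "v \<in> carrier_vec ?n" "v \<noteq> 0\<^sub>v ?n" "kmat S A *\<^sub>v v = 0\<^sub>v ?n"
    using det_0_iff_vec_prod_zero_field[of "kmat S A" ?n] by (auto simp: kdet_def)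
  define \<phi> where "\<phi> x = Matrix.vec_index v (to_nat_on S x)" for x
  have "(\<Sum>w\<in>S. A x w * \<phi> w) = 0" if x: "x \<in> S" for x
  proof -
    let ?i = "to_nat_on S x"
    have i: "?i < ?n" by (rule to_nat_on_less[OF S x])
    have "(\<Sum>w\<in>S. A x w * \<phi> w) = (\<Sum>j<?n. A x (from_nat_into S j) * \<phi> (from_nat_into S j))"
      by (rule sum.reindex_bij_betw[OF bij_from_nat_into[OF S], symmetric])
    also have "\<dots> = (\<Sum>j<?n. kmat S A $$ (?i, j) * Matrix.vec_index v j)"
      using i by (intro sum.cong)
        (auto simp: kmat_def \<phi>_def from_to_nat_on[OF S x] to_from_nat_on[OF S])
    also have "\<dots> = Matrix.vec_index (kmat S A *\<^sub>v v) ?i"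
      using i v(1) by (simp add: scalar_prod_def atLeast0LessThan kmat_def)
    finally show ?thesis
      using v(3) i by simp
  qed
  then have "\<forall>x\<in>S. \<phi> x = 0"
    by (rule inj)
  then have "Matrix.vec_index v j = 0" if "j < ?n" for j
    using that bij_betwE[OF bij_from_nat_into[OF S]] to_from_nat_on[OF S that]
    by (metis \<phi>_def lessThan_iff)
  then have "v = 0\<^sub>v ?n"
    using v(1) by (intro eq_vecI) auto
  with v(2) show False by simp
qed

lemma poly_kdet: "poly (kdet S A) r = kdet S (\<lambda>x y. poly (A x y) r)" for A :: "'a \<Rightarrow> 'a \<Rightarrow> 'b::comm_ring_1 poly"
proof -
  interpret comm_ring_hom "\<lambda>p. poly p r"
    by unfold_locales auto
  have "map_mat (\<lambda>p. poly p r) (kmat S A) = kmat S (\<lambda>x y. poly (A x y) r)"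
    by (rule eq_matI) (auto simp: kmat_def)
  then show ?thesis
    by (metis hom_det kdet_def)
qed

text \<open>Every product in the Leibniz formula takes exactly one entry from each row, so bounds by
  row add up.\<close>

lemma degree_det_le:
  fixes M :: "'b::comm_ring_1 poly Matrix.mat"
  assumes M: "M \<in> carrier_mat n n"
    and deg: "\<And>i j. i < n \<Longrightarrow> j < n \<Longrightarrow> degree (M $$ (i, j)) \<le> d i"
  shows "degree (Determinant.det M) \<le> (\<Sum>i<n. d i)"
proof -
  have "degree (signof p * (\<Prod>i = 0..<n. M $$ (i, p i))) \<le> (\<Sum>i<n. d i)"
    if p: "p permutes {0..<n}" for p
  proof -
    have "degree (\<Prod>i = 0..<n. M $$ (i, p i)) \<le> (\<Sum>i = 0..<n. degree (M $$ (i, p i)))"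
      using degree_prod_sum_le[of "{0..<n}" "\<lambda>i. M $$ (i, p i)"] by (simp add: o_def)
    also have "\<dots> \<le> (\<Sum>i = 0..<n. d i)"
      using permutes_in_image[OF p] by (intro sum_mono deg) auto
    finally show ?thesis
      by (simp add: sign_def atLeast0LessThan)
  qed
  then show ?thesis
    unfolding det_def'[OF M] by (intro degree_sum_le) (auto simp: finite_permutations)
qed

lemma measurable_det:
  fixes M :: "'c \<Rightarrow> complex Matrix.mat"
  assumes M: "\<And>\<omega>. M \<omega> \<in> carrier_mat n n"
    and meas: "\<And>i j. i < n \<Longrightarrow> j < n \<Longrightarrow> (\<lambda>\<omega>. M \<omega> $$ (i, j)) \<in> borel_measurable N"
  shows "(\<lambda>\<omega>. Determinant.det (M \<omega>)) \<in> borel_measurable N"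
  unfolding det_def'[OF M]
  by (intro borel_measurable_sum borel_measurable_times borel_measurable_prod meas borel_measurable_const)
    (auto dest: permutes_in_image)

lemma kadj_eq:
  assumes S: "finite S" and x: "x \<in> S" and y: "y \<in> S"
  shows "kadj S A x y = (- 1) ^ (to_nat_on S y + to_nat_on S x) *
    Determinant.det (mat_delete (kmat S A) (to_nat_on S y) (to_nat_on S x))"
  using to_nat_on_less[OF S x] to_nat_on_less[OF S y]
  by (simp add: kadj_def adj_mat_def cofactor_def kmat_def)

text \<open>Only the rows in \<open>T\<close> contain the variable, each to degree one. A cofactor
  deletes one row, which cannot raise the count.\<close>

lemma degree_kdet_le:
  fixes A :: "'a \<Rightarrow> 'a \<Rightarrow> 'b::comm_ring_1 poly"
  assumes S: "finite S" and T: "T \<subseteq> S"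
    and deg: "\<And>x y. degree (A x y) \<le> of_bool (x \<in> T)"
  shows "degree (kdet S A) \<le> card T"
    and "x \<in> S \<Longrightarrow> y \<in> S \<Longrightarrow> degree (kadj S A x y) \<le> card T"
proof -
  let ?d = "\<lambda>i. of_bool (from_nat_into S i \<in> T) :: nat"
  have sum: "(\<Sum>i<card S. ?d i) = card T"
    using sum.reindex_bij_betw[OF bij_from_nat_into[OF S], of "\<lambda>x. of_bool (x \<in> T) :: nat"] T S
    by (simp add: Int_absorb1)
  show "degree (kdet S A) \<le> card T"
    unfolding kdet_def sum[symmetric]
    by (rule degree_det_le) (auto simp: kmat_def deg)
  assume x: "x \<in> S" and y: "y \<in> S"
  let ?n = "card S" and ?k = "to_nat_on S y" and ?l = "to_nat_on S x"
  have k: "?k < ?n" and l: "?l < ?n"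
    using to_nat_on_less[OF S] x y by auto
  \<comment> \<open>Row \<open>i\<close> of the minor is row \<open>insert_index ?k i\<close> of the
    full matrix: the map skips the deleted row.\<close>
  have "degree (Determinant.det (mat_delete (kmat S A) ?k ?l)) \<le>
      (\<Sum>i<?n - 1. ?d (insert_index ?k i))"
    by (rule degree_det_le) (use k l in \<open>auto simp: mat_delete_def kmat_def deg insert_index_def\<close>)
  also have "\<dots> = sum ?d (insert_index ?k ` {..<?n - 1})"
    by (rule sum.reindex[symmetric, unfolded o_def]) (rule insert_index_inj_on)
  also have "\<dots> \<le> (\<Sum>i<?n. ?d i)"
    by (intro sum_mono2) (auto simp: insert_index_def)
  finally have "degree (Determinant.det (mat_delete (kmat S A) ?k ?l)) \<le> card T"
    by (simp only: sum)
  then show "degree (kadj S A x y) \<le> card T"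
    unfolding kadj_eq[OF S x y] by (cases "even (?k + ?l)") auto
qed

lemma measurable_kdet:
  fixes A :: "'c \<Rightarrow> 'a \<Rightarrow> 'a \<Rightarrow> complex"
  assumes S: "finite S"
    and meas: "\<And>x y. (\<lambda>\<omega>. A \<omega> x y) \<in> borel_measurable N"
  shows "(\<lambda>\<omega>. kdet S (A \<omega>)) \<in> borel_measurable N"
    and "x \<in> S \<Longrightarrow> y \<in> S \<Longrightarrow> (\<lambda>\<omega>. kadj S (A \<omega>) x y) \<in> borel_measurable N"
proof -
  show "(\<lambda>\<omega>. kdet S (A \<omega>)) \<in> borel_measurable N"
    unfolding kdet_def by (rule measurable_det[where n = "card S"]) (simp, simp add: kmat_def meas)
  assume x: "x \<in> S" and y: "y \<in> S"
  let ?n = "card S" and ?k = "to_nat_on S y" and ?l = "to_nat_on S x"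
  have k: "?k < ?n" and l: "?l < ?n"
    using to_nat_on_less[OF S] x y by auto
  have "(\<lambda>\<omega>. Determinant.det (mat_delete (kmat S (A \<omega>)) ?k ?l)) \<in> borel_measurable N"
    by (rule measurable_det[where n = "?n - 1"])
      (use k l in \<open>auto simp: mat_delete_def kmat_def insert_index_def intro!: meas\<close>)
  then show "(\<lambda>\<omega>. kadj S (A \<omega>) x y) \<in> borel_measurable N"
    unfolding kadj_eq[OF S x y] by measurable
qed

section \<open>Hopping operators on a graph of bounded degree\<close>

locale hopping =
  fixes adj :: "'a \<Rightarrow> 'a \<Rightarrow> bool" and D :: nat
  assumes adj_sym: "adj x y \<longleftrightarrow> adj y x"
    and finite_nbrs: "finite {y. adj x y}"
    and card_nbrs: "card {y. adj x y} \<le> D"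
begin

definition hop :: "'a set \<Rightarrow> ('a \<Rightarrow> complex) \<Rightarrow> 'a \<Rightarrow> complex" where
  "hop S \<psi> x = (\<Sum>y\<in>S. of_bool (adj x y) * \<psi> y)"

lemma hop_nbrs: "finite S \<Longrightarrow> hop S \<psi> x = (\<Sum>y\<in>S \<inter> {y. adj x y}. \<psi> y)"
  unfolding hop_def by (subst sum.inter_restrict) (auto intro!: sum.cong simp: of_bool_def)

lemma norm_hop_le:
  assumes S: "finite S" and N: "\<And>y. y \<in> S \<Longrightarrow> adj x y \<Longrightarrow> cmod (\<psi> y) \<le> N" "0 \<le> N"
  shows "cmod (hop S \<psi> x) \<le> real D * N"
proof -
  have "cmod (hop S \<psi> x) \<le> (\<Sum>y\<in>S \<inter> {y. adj x y}. cmod (\<psi> y))"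
    unfolding hop_nbrs[OF S] by (rule norm_sum)
  also have "\<dots> \<le> real (card (S \<inter> {y. adj x y})) * N"
    using N(1) by (intro sum_bounded_above) auto
  also have "card (S \<inter> {y. adj x y}) \<le> D"
    using card_mono[OF finite_nbrs[of x], of "S \<inter> {y. adj x y}"] card_nbrs[of x] by simp
  then have "real (card (S \<inter> {y. adj x y})) * N \<le> real D * N"
    using N(2) by (intro mult_right_mono) auto
  finally show ?thesis .
qed

lemma hop_Un:
  assumes "finite S" "finite T" "S \<inter> T = {}"
  shows "hop (S \<union> T) \<psi> x = hop S \<psi> x + hop T \<psi> x"
  unfolding hop_def using assms by (rule sum.union_disjoint)

lemma hop_diff: "hop S (\<lambda>x. \<psi> x - \<phi> x) x = hop S \<psi> x - hop S \<phi> x"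
  by (simp add: hop_def right_diff_distrib sum_subtractf)

lemma hop_add: "hop S (\<lambda>x. \<psi> x + \<phi> x) x = hop S \<psi> x + hop S \<phi> x"
  by (simp add: hop_def distrib_left sum.distrib)

lemma hop_sum: "hop S (\<lambda>x. \<Sum>v\<in>T. \<psi> v x * c v) x = (\<Sum>v\<in>T. hop S (\<psi> v) x * c v)"
proof -
  have "hop S (\<lambda>x. \<Sum>v\<in>T. \<psi> v x * c v) x = (\<Sum>y\<in>S. \<Sum>v\<in>T. of_bool (adj x y) * \<psi> v y * c v)"
    by (simp add: hop_def sum_distrib_left mult.assoc)
  also have "\<dots> = (\<Sum>v\<in>T. \<Sum>y\<in>S. of_bool (adj x y) * \<psi> v y * c v)"
    by (rule sum.swap)
  finally show ?thesis
    by (simp add: hop_def sum_distrib_right)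
qed

text \<open>The adjacency relation is symmetric, so the quadratic form equals its own
  conjugate.\<close>

lemma Im_inner_hop: "Im (\<Sum>x\<in>S. cnj (\<psi> x) * hop S \<psi> x) = 0"
proof -
  have [simp]: "cnj (of_bool b) = of_bool b" for b
    by (simp add: of_bool_def)
  let ?Q = "\<Sum>x\<in>S. cnj (\<psi> x) * hop S \<psi> x"
  have "cnj ?Q = (\<Sum>x\<in>S. \<Sum>y\<in>S. of_bool (adj x y) * \<psi> x * cnj (\<psi> y))"
    by (simp add: hop_def sum_distrib_left mult_ac)
  also have "\<dots> = (\<Sum>y\<in>S. \<Sum>x\<in>S. of_bool (adj x y) * \<psi> x * cnj (\<psi> y))"
    by (rule sum.swap)
  also have "\<dots> = ?Q"
    by (simp add: hop_def sum_distrib_left mult_ac adj_sym)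
  finally have "Im (cnj ?Q) = Im ?Q"
    by (rule arg_cong)
  then show ?thesis
    by (simp only: cnj.sel)
qed

text \<open>Pair the equation with \<open>\<psi>\<close> and take imaginary parts: the hopping term
  is real and drops out.\<close>

lemma energy_identity:
  assumes "\<And>x. x \<in> S \<Longrightarrow> a x * \<psi> x - hop S \<psi> x = g x"
  shows "(\<Sum>x\<in>S. Im (a x) * (cmod (\<psi> x))\<^sup>2) = Im (\<Sum>x\<in>S. cnj (\<psi> x) * g x)"
proof -
  have "Im (a x) * (cmod (\<psi> x))\<^sup>2 = Im (cnj (\<psi> x) * (a x * \<psi> x))" for x
    by (simp add: cmod_power2) (simp add: power2_eq_square algebra_simps)
  then have "(\<Sum>x\<in>S. Im (a x) * (cmod (\<psi> x))\<^sup>2) = Im (\<Sum>x\<in>S. cnj (\<psi> x) * (a x * \<psi> x))"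
    by simp
  also have "(\<Sum>x\<in>S. cnj (\<psi> x) * (a x * \<psi> x)) =
      (\<Sum>x\<in>S. cnj (\<psi> x) * g x) + (\<Sum>x\<in>S. cnj (\<psi> x) * hop S \<psi> x)"
    unfolding sum.distrib[symmetric] using assms
    by (intro sum.cong) (auto simp flip: distrib_left assms)
  finally show ?thesis
    by (simp only: plus_complex.sel Im_inner_hop)
qed

lemma energy_estimate:
  assumes eq: "\<And>x. x \<in> S \<Longrightarrow> a x * \<psi> x - hop S \<psi> x = g x"
    and e: "\<forall>x\<in>S. Im (a x) = e"
  shows "e\<^sup>2 * (\<Sum>x\<in>S. (cmod (\<psi> x))\<^sup>2) \<le> (\<Sum>x\<in>S. (cmod (g x))\<^sup>2)"
proof -
  let ?A = "\<Sum>x\<in>S. (cmod (\<psi> x))\<^sup>2"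
  have "e * ?A = Im (\<Sum>x\<in>S. cnj (\<psi> x) * g x)"
    using energy_identity[of S a \<psi> g, OF eq] e by (simp add: sum_distrib_left)
  moreover have "\<bar>e\<bar> * ?A = \<bar>e * ?A\<bar>"
    by (simp add: abs_mult sum_nonneg)
  ultimately have "\<bar>e\<bar> * ?A = \<bar>Im (\<Sum>x\<in>S. cnj (\<psi> x) * g x)\<bar>"
    by (simp only:)
  also have "\<dots> \<le> cmod (\<Sum>x\<in>S. cnj (\<psi> x) * g x)"
    by (rule abs_Im_le_cmod)
  also have "\<dots> \<le> (\<Sum>x\<in>S. cmod (\<psi> x) * cmod (g x))"
    by (rule sum_norm_le) (simp add: norm_mult)
  \<comment> \<open>The factor \<open>2 * \<bar>e\<bar>\<close> prepares for
    \<open>2 * a * b \<le> a\<^sup>2 + b\<^sup>2\<close> with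
    \<open>a = \<bar>e\<bar> * cmod (\<psi> x)\<close>; half of the left side then absorbs the
    resulting \<open>e\<^sup>2 * ?A\<close>.\<close>
  finally have "2 * \<bar>e\<bar> * (\<bar>e\<bar> * ?A) \<le> 2 * \<bar>e\<bar> * (\<Sum>x\<in>S. cmod (\<psi> x) * cmod (g x))"
    by (intro mult_left_mono) auto
  also have "\<dots> = (\<Sum>x\<in>S. 2 * (\<bar>e\<bar> * cmod (\<psi> x)) * cmod (g x))"
    by (simp add: sum_distrib_left mult_ac)
  also have "\<dots> \<le> (\<Sum>x\<in>S. (\<bar>e\<bar> * cmod (\<psi> x))\<^sup>2 + (cmod (g x))\<^sup>2)"
    by (intro sum_mono sum_squares_bound)
  also have "\<dots> = e\<^sup>2 * ?A + (\<Sum>x\<in>S. (cmod (g x))\<^sup>2)"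
    by (simp add: sum.distrib sum_distrib_left power_mult_distrib)
  finally show ?thesis
    by (simp add: power2_eq_square)
qed

text \<open>The margin \<open>D * card \<Phi>\<close> pays for the hopping from \<open>I\<close>,
  which is at most \<open>D * N\<close> at each of at most \<open>card \<Phi>\<close> sites, where
  \<open>N\<close> is the maximum of \<open>cmod \<psi>\<close> on the block. The source is a
  general \<open>c\<close> because the lemma will be applied to a column of an adjugate, whose
  source is a determinant that could vanish.\<close>

lemma block_bound:
  assumes \<Gamma>: "finite \<Gamma>" and \<Phi>: "\<Phi> \<subseteq> \<Gamma>" and I: "I \<subseteq> \<Phi>" and v: "v \<in> \<Phi>"
    and s: "\<bar>s\<bar> = 1" and l: "0 < l"
    and nbrs: "\<And>x y. x \<in> I \<Longrightarrow> y \<in> \<Gamma> \<Longrightarrow> adj x y \<Longrightarrow> y \<in> \<Phi>"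
    and outer: "\<And>x. x \<in> \<Gamma> - \<Phi> \<Longrightarrow> 0 \<le> s * Im (a x)"
    and bdry: "\<And>x. x \<in> \<Phi> - I \<Longrightarrow> real D * real (card \<Phi>) + l \<le> s * Im (a x)"
    and inner: "\<And>x. x \<in> I \<Longrightarrow> real D + l \<le> cmod (a x)"
    and eq: "\<And>x. x \<in> \<Gamma> \<Longrightarrow> a x * \<psi> x - hop \<Gamma> \<psi> x = of_bool (x = v) * c"
    and x: "x \<in> \<Phi>"
  shows "l * cmod (\<psi> x) \<le> cmod c"
proof -
  have fin: "finite \<Phi>" "finite I"
    using finite_subset[OF \<Phi> \<Gamma>] finite_subset[OF I] by auto
  define N where "N = Max ((\<lambda>x. cmod (\<psi> x)) ` \<Phi>)"
  have N: "cmod (\<psi> y) \<le> N" if "y \<in> \<Phi>" for y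
    unfolding N_def using fin that by simp
  have N0: "0 \<le> N"
    using N[OF x] norm_ge_zero order_trans by blast
  have "N \<in> (\<lambda>x. cmod (\<psi> x)) ` \<Phi>"
    unfolding N_def using fin x by (intro Max_in) auto
  then obtain x0 where x0: "x0 \<in> \<Phi>" "cmod (\<psi> x0) = N"
    by auto
  have "l * N \<le> cmod c"
  proof (cases "x0 \<in> I")
    case True
    have "cmod (a x0 * \<psi> x0) = cmod (of_bool (x0 = v) * c + hop \<Gamma> \<psi> x0)"
      using eq[of x0] x0 \<Phi> by (simp add: diff_eq_eq subset_iff)
    also have "\<dots> \<le> cmod c + real D * N"
      by (intro order_trans[OF norm_triangle_ineq] add_mono norm_hop_le \<Gamma> N0)
        (auto simp: norm_mult intro!: N nbrs[OF True])
    finally have "cmod (a x0) * N \<le> cmod c + real D * N"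
      by (simp add: norm_mult x0)
    moreover have "(real D + l) * N \<le> cmod (a x0) * N"
      using inner[OF True] N0 by (rule mult_right_mono)
    ultimately show ?thesis
      by (simp add: algebra_simps)
  next
    case False
    \<comment> \<open>On \<open>I\<close> the sign of \<open>Im (a x)\<close> is unknown. The energy
      identity is therefore used on the rest of the volume, and the values on \<open>I\<close> enter
      as an additional source.\<close>
    let ?S = "\<Gamma> - I"
    define g where "g x = of_bool (x = v) * c + hop I \<psi> x" for x
    have finS: "finite ?S" using \<Gamma> by simp
    have "a x * \<psi> x - hop ?S \<psi> x = g x" if "x \<in> ?S" for x
    proof -
      have "hop \<Gamma> \<psi> x = hop ?S \<psi> x + hop I \<psi> x"
        using hop_Un[of ?S I \<psi> x] finS fin \<Phi> I by (simp add: Un_absorb2 Diff_disjoint Int_commute)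
      then show ?thesis
        using eq[of x] that by (simp add: g_def algebra_simps)
    qed
    from energy_identity[of ?S a \<psi> g, OF this]
    have energy: "(\<Sum>x\<in>?S. s * Im (a x) * (cmod (\<psi> x))\<^sup>2) = s * Im (\<Sum>x\<in>?S. cnj (\<psi> x) * g x)"
      by (simp only: mult.assoc sum_distrib_left[symmetric])
    \<comment> \<open>Neighbours of \<open>I\<close> within the volume lie in the block, so the new
      source does not reach beyond it.\<close>
    have g0: "g x = 0" if "x \<in> ?S - \<Phi>" for x
    proof -
      have "hop I \<psi> x = 0"
        unfolding hop_def using that nbrs adj_sym by (intro sum.neutral) (auto simp: of_bool_def)
      then show ?thesis
        using that v by (auto simp: g_def)
    qed
    \<comment> \<open>All terms of the energy sum are nonnegative, so the single term at the maximal
      site bounds it from below.\<close>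
    have "(real D * real (card \<Phi>) + l) * N\<^sup>2 \<le> s * Im (a x0) * (cmod (\<psi> x0))\<^sup>2"
      unfolding x0(2) using bdry[of x0] x0 False by (intro mult_right_mono) auto
    also have "\<dots> \<le> (\<Sum>x\<in>?S. s * Im (a x) * (cmod (\<psi> x))\<^sup>2)"
    proof (rule member_le_sum[of x0 ?S "\<lambda>x. s * Im (a x) * (cmod (\<psi> x))\<^sup>2"])
      show "x0 \<in> ?S" using x0 \<Phi> False by auto
      fix x assume x: "x \<in> ?S - {x0}"
      have "0 \<le> s * Im (a x)"
      proof (cases "x \<in> \<Phi>")
        case True
        then have "real D * real (card \<Phi>) + l \<le> s * Im (a x)" using x bdry by auto
        moreover have "0 \<le> real D * real (card \<Phi>)" by simp
        ultimately show ?thesis using l by linarith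
      qed (use x outer in auto)
      then show "0 \<le> s * Im (a x) * (cmod (\<psi> x))\<^sup>2" by simp
    qed (use finS in auto)
    also have "\<dots> \<le> cmod (\<Sum>x\<in>?S. cnj (\<psi> x) * g x)"
      unfolding energy using abs_Im_le_cmod[of "\<Sum>x\<in>?S. cnj (\<psi> x) * g x"] s
      by (cases "s = 1") (auto simp: abs_if split: if_splits)
    also have "(\<Sum>x\<in>?S. cnj (\<psi> x) * g x) = (\<Sum>x\<in>\<Phi> - I. cnj (\<psi> x) * g x)"
      using \<Phi> finS g0 by (intro sum.mono_neutral_right) auto
    also have "cmod \<dots> \<le> (\<Sum>x\<in>\<Phi> - I. N * (real D * N) + of_bool (x = v) * (N * cmod c))"
    proof (rule sum_norm_le)
      fix x assume x: "x \<in> \<Phi> - I"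
      have "cmod (g x) \<le> of_bool (x = v) * cmod c + real D * N"
        unfolding g_def using N I
        by (intro order_trans[OF norm_triangle_ineq] add_mono norm_hop_le fin N0) (auto simp: norm_mult)
      then have "cmod (\<psi> x) * cmod (g x) \<le> N * (of_bool (x = v) * cmod c + real D * N)"
        using N[of x] x N0 by (intro mult_mono) auto
      then show "cmod (cnj (\<psi> x) * g x) \<le> N * (real D * N) + of_bool (x = v) * (N * cmod c)"
        by (simp add: norm_mult algebra_simps)
    qed
    also have "\<dots> \<le> real (card \<Phi>) * (N * (real D * N)) + N * cmod c"
    proof -
      have "card (\<Phi> - I) \<le> card \<Phi>"
        using fin by (intro card_mono) auto
      then have "real (card (\<Phi> - I)) * (N * (real D * N)) \<le> real (card \<Phi>) * (N * (real D * N))"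
        using N0 by (intro mult_right_mono) auto
      moreover have "(\<Sum>x\<in>\<Phi> - I. of_bool (x = v) * (N * cmod c)) \<le> N * cmod c"
        using fin N0 by (simp add: of_bool_def if_distrib if_distribR sum.delta cong: if_cong)
      ultimately show ?thesis
        by (simp add: sum.distrib)
    qed
    finally have "N * (l * N) \<le> N * cmod c"
      by (simp add: algebra_simps power2_eq_square)
    then show ?thesis
      using N0 by (cases "N = 0") (auto simp: mult_le_cancel_left)
  qed
  moreover have "l * cmod (\<psi> x) \<le> l * N"
    using N[OF x] l by simp
  ultimately show ?thesis by simp
qed

section \<open>Green functions of finite volumes\<close>

definition op_kernel :: "('a \<Rightarrow> complex) \<Rightarrow> 'a \<Rightarrow> 'a \<Rightarrow> complex" where
  "op_kernel a x y = of_bool (x = y) * a x - of_bool (adj x y)"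

text \<open>Cramer's rule for the inverse of \<open>a - hop \<Gamma>\<close>. Being zero outside the
  volume, it can serve as a function on the whole graph when volumes are compared.\<close>

definition gf :: "'a set \<Rightarrow> ('a \<Rightarrow> complex) \<Rightarrow> 'a \<Rightarrow> 'a \<Rightarrow> complex" where
  "gf \<Gamma> a x y = (if x \<in> \<Gamma> \<and> y \<in> \<Gamma>
     then kadj \<Gamma> (op_kernel a) x y / kdet \<Gamma> (op_kernel a) else 0)"

lemma sum_op_kernel:
  assumes "finite \<Gamma>" "x \<in> \<Gamma>"
  shows "(\<Sum>w\<in>\<Gamma>. op_kernel a x w * \<phi> w) = a x * \<phi> x - hop \<Gamma> \<phi> x"
proof -
  have "(\<Sum>w\<in>\<Gamma>. op_kernel a x w * \<phi> w) = (\<Sum>w\<in>\<Gamma>. if x = w then a w * \<phi> w else 0) - hop \<Gamma> \<phi> x"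
    unfolding hop_def sum_subtractf[symmetric]
    by (intro sum.cong) (auto simp: op_kernel_def algebra_simps)
  then show ?thesis
    using assms by simp
qed

lemma gf_cong:
  assumes "finite \<Gamma>" "\<And>w. w \<in> \<Gamma> \<Longrightarrow> a w = b w"
  shows "gf \<Gamma> a x y = gf \<Gamma> b x y"
proof -
  have "kmat \<Gamma> (op_kernel a) = kmat \<Gamma> (op_kernel b)"
    using assms bij_betwE[OF bij_from_nat_into[OF assms(1)]]
    by (intro eq_matI) (auto simp: kmat_def op_kernel_def)
  then show ?thesis
    by (simp add: gf_def kdet_def kadj_def)
qed

text \<open>The energy estimate with source zero forces the squared norm to vanish. This is the
  finite-volume statement that a nonreal number is not an eigenvalue.\<close>

lemma zero_solution:
  assumes \<Gamma>: "finite \<Gamma>" and e: "\<forall>x\<in>\<Gamma>. Im (a x) = e" "e \<noteq> 0"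
    and eq: "\<forall>x\<in>\<Gamma>. a x * \<psi> x - hop \<Gamma> \<psi> x = 0"
  shows "\<forall>x\<in>\<Gamma>. \<psi> x = 0"
proof -
  have "e\<^sup>2 * (\<Sum>x\<in>\<Gamma>. (cmod (\<psi> x))\<^sup>2) \<le> 0"
    using energy_estimate[of \<Gamma> a \<psi> "\<lambda>_. 0" e] eq e(1) by simp
  then have "(\<Sum>x\<in>\<Gamma>. (cmod (\<psi> x))\<^sup>2) \<le> 0"
    using e(2) by (simp add: mult_le_0_iff)
  then show ?thesis
    using \<Gamma> sum_nonneg_eq_0_iff[of \<Gamma> "\<lambda>x. (cmod (\<psi> x))\<^sup>2"]
      sum_nonneg[of \<Gamma> "\<lambda>x. (cmod (\<psi> x))\<^sup>2"] by simp
qed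

lemma kdet_op_kernel_nonzero:
  assumes "finite \<Gamma>" "\<forall>x\<in>\<Gamma>. Im (a x) = e" "e \<noteq> 0"
  shows "kdet \<Gamma> (op_kernel a) \<noteq> 0"
proof (rule kdet_nonzero[OF assms(1)])
  fix \<phi> assume "\<And>x. x \<in> \<Gamma> \<Longrightarrow> (\<Sum>w\<in>\<Gamma>. op_kernel a x w * \<phi> w) = 0"
  then show "\<forall>x\<in>\<Gamma>. \<phi> x = 0"
    by (intro zero_solution[OF assms, of \<phi>]) (simp add: sum_op_kernel assms(1))
qed

lemma gf_eq:
  assumes \<Gamma>: "finite \<Gamma>" and e: "\<forall>x\<in>\<Gamma>. Im (a x) = e" "e \<noteq> 0"
    and x: "x \<in> \<Gamma>" and y: "y \<in> \<Gamma>"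
  shows "a x * gf \<Gamma> a x y - hop \<Gamma> (\<lambda>w. gf \<Gamma> a w y) x = of_bool (x = y)"
proof -
  let ?d = "kdet \<Gamma> (op_kernel a)"
  have "(\<Sum>w\<in>\<Gamma>. op_kernel a x w * gf \<Gamma> a w y) = (\<Sum>w\<in>\<Gamma>. op_kernel a x w * kadj \<Gamma> (op_kernel a) w y) / ?d"
    using y by (simp add: gf_def sum_divide_distrib)
  also have "\<dots> = of_bool (x = y)"
    using kdet_op_kernel_nonzero[OF \<Gamma> e] by (simp add: kadj_right \<Gamma> x y)
  finally show ?thesis
    by (simp add: sum_op_kernel \<Gamma> x)
qed

lemma gf_unique:
  assumes \<Gamma>: "finite \<Gamma>" and e: "\<forall>x\<in>\<Gamma>. Im (a x) = e" "e \<noteq> 0"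
    and y: "y \<in> \<Gamma>" and x: "x \<in> \<Gamma>"
    and eq: "\<And>x. x \<in> \<Gamma> \<Longrightarrow> a x * \<psi> x - hop \<Gamma> \<psi> x = of_bool (x = y)"
  shows "gf \<Gamma> a x y = \<psi> x"
proof -
  have "\<forall>x\<in>\<Gamma>. a x * (\<psi> x - gf \<Gamma> a x y) - hop \<Gamma> (\<lambda>x. \<psi> x - gf \<Gamma> a x y) x = 0"
  proof
    fix x assume "x \<in> \<Gamma>"
    then have "a x * \<psi> x = of_bool (x = y) + hop \<Gamma> \<psi> x"
      "a x * gf \<Gamma> a x y = of_bool (x = y) + hop \<Gamma> (\<lambda>x. gf \<Gamma> a x y) x"
      using eq[of x] gf_eq[OF \<Gamma> e, of x y] y by (simp_all add: diff_eq_eq)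
    then show "a x * (\<psi> x - gf \<Gamma> a x y) - hop \<Gamma> (\<lambda>x. \<psi> x - gf \<Gamma> a x y) x = 0"
      by (simp add: hop_diff right_diff_distrib)
  qed
  from zero_solution[OF \<Gamma> e this] x show ?thesis
    by simp
qed

text \<open>This is the resolvent identity for cutting all bonds between \<open>\<Phi>\<close> and
  its complement. The term for the decoupled volume is absent because \<open>x\<close> and
  \<open>y\<close> lie on different sides of the cut.\<close>

lemma gf_resolvent_expansion:
  assumes \<Gamma>: "finite \<Gamma>" and e: "\<forall>x\<in>\<Gamma>. Im (a x) = e" "e \<noteq> 0"
    and \<Phi>: "\<Phi> \<subseteq> \<Gamma>" and x: "x \<in> \<Phi>" and y: "y \<in> \<Gamma> - \<Phi>"
  shows "gf \<Gamma> a x y = (\<Sum>v\<in>\<Phi>. gf \<Gamma> a x v * hop (\<Gamma> - \<Phi>) (\<lambda>w. gf (\<Gamma> - \<Phi>) a w y) v)"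
proof -
  let ?R = "\<Gamma> - \<Phi>"
  define \<phi> where "\<phi> w = gf ?R a w y" for w
  define \<zeta> where "\<zeta> w = (\<Sum>v\<in>\<Phi>. gf \<Gamma> a w v * hop ?R \<phi> v)" for w
  have fin: "finite \<Phi>" "finite ?R"
    using \<Gamma> finite_subset[OF \<Phi>] by auto
  have \<phi>0: "\<phi> w = 0" if "w \<in> \<Phi>" for w
    using that by (simp add: \<phi>_def gf_def)
  have hop\<phi>: "hop \<Gamma> \<phi> w = hop ?R \<phi> w" for w
    unfolding hop_def using \<Gamma> \<Phi> \<phi>0 by (intro sum.mono_neutral_right) auto
  \<comment> \<open>Extended by zero, the Green function of the smaller volume violates the equation
    only on \<open>\<Phi>\<close>, by the hopping across the cut.\<close>
  have eq\<phi>: "a w * \<phi> w - hop \<Gamma> \<phi> w = of_bool (w = y) - (if w \<in> \<Phi> then hop ?R \<phi> w else 0)"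
    if w: "w \<in> \<Gamma>" for w
  proof (cases "w \<in> \<Phi>")
    case True
    then show ?thesis using y by (auto simp: \<phi>0 hop\<phi>)
  next
    case False
    then have "a w * \<phi> w - hop ?R \<phi> w = of_bool (w = y)"
      using gf_eq[OF fin(2), of a e w y] e w y by (simp add: \<phi>_def[abs_def])
    then show ?thesis
      using False by (simp add: hop\<phi>)
  qed
  \<comment> \<open>The correction is built from columns of the full Green function so as to cancel
    exactly this defect.\<close>
  have eq\<zeta>: "a w * \<zeta> w - hop \<Gamma> \<zeta> w = (if w \<in> \<Phi> then hop ?R \<phi> w else 0)" if w: "w \<in> \<Gamma>" for w
  proof -
    have "a w * \<zeta> w - hop \<Gamma> \<zeta> w =
        (\<Sum>v\<in>\<Phi>. (a w * gf \<Gamma> a w v - hop \<Gamma> (\<lambda>w. gf \<Gamma> a w v) w) * hop ?R \<phi> v)"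
      unfolding \<zeta>_def by (subst hop_sum) (simp add: sum_distrib_left sum_subtractf algebra_simps)
    also have "\<dots> = (\<Sum>v\<in>\<Phi>. if w = v then hop ?R \<phi> v else 0)"
    proof (intro sum.cong refl)
      fix v assume "v \<in> \<Phi>"
      then have "a w * gf \<Gamma> a w v - hop \<Gamma> (\<lambda>w. gf \<Gamma> a w v) w = of_bool (w = v)"
        using gf_eq[OF \<Gamma> e w, of v] \<Phi> by auto
      then show "(a w * gf \<Gamma> a w v - hop \<Gamma> (\<lambda>w. gf \<Gamma> a w v) w) * hop ?R \<phi> v =
          (if w = v then hop ?R \<phi> v else 0)"
        by simp
    qed
    finally show ?thesis
      using fin by simp
  qed
  have "gf \<Gamma> a x y = \<phi> x + \<zeta> x"
    using x y \<Phi> eq\<phi> eq\<zeta>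
    by (intro gf_unique[OF \<Gamma> e, of y x "\<lambda>w. \<phi> w + \<zeta> w"]) (auto simp: hop_add algebra_simps)
  then have "gf \<Gamma> a x y = \<zeta> x"
    by (simp add: \<phi>0 x)
  then show ?thesis
    by (simp add: \<zeta>_def \<phi>_def[abs_def])
qed

text \<open>Cramer's rule with polynomial entries. The last clause avoids division: at every complex
  \<open>r\<close>, including points where the imaginary part of the diagonal is not constant,
  \<open>poly p r\<close> is the value at \<open>x\<close> of a solution with source
  \<open>poly q r\<close>. This is the form to which \<open>block_bound\<close> applies.\<close>

lemma gf_rational:
  fixes a b :: "'a \<Rightarrow> complex"
  assumes \<Gamma>: "finite \<Gamma>" and \<Phi>: "\<Phi> \<subseteq> \<Gamma>" and x: "x \<in> \<Phi>" and v: "v \<in> \<Phi>"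
    and b: "\<And>w. w \<in> \<Gamma> - \<Phi> \<Longrightarrow> b w = 0"
  shows "\<exists>p q. degree p \<le> card \<Phi> \<and> degree q \<le> card \<Phi> \<and>
    (\<forall>r e. e \<noteq> 0 \<longrightarrow> (\<forall>w\<in>\<Gamma>. Im (a w + r * b w) = e) \<longrightarrow>
      poly q r \<noteq> 0 \<and> gf \<Gamma> (\<lambda>w. a w + r * b w) x v = poly p r / poly q r) \<and>
    (\<forall>r. \<exists>\<psi>. \<psi> x = poly p r \<and>
      (\<forall>w\<in>\<Gamma>. (a w + r * b w) * \<psi> w - hop \<Gamma> \<psi> w = of_bool (w = v) * poly q r))"
proof -
  \<comment> \<open>The restriction to \<open>w \<in> \<Phi>\<close> makes the row degrees correct
    for all \<open>w\<close>; on \<open>\<Gamma>\<close> it changes nothing, since \<open>b\<close>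
    vanishes on \<open>\<Gamma> - \<Phi>\<close>.\<close>
  define A where "A w y = [: of_bool (w = y) * a w - of_bool (adj w y),
    of_bool (w = y \<and> w \<in> \<Phi>) * b w :]" for w y
  define p where "p w = kadj \<Gamma> A w v" for w
  define q where "q = kdet \<Gamma> A"
  have x': "x \<in> \<Gamma>" and v': "v \<in> \<Gamma>"
    using x v \<Phi> by auto
  have deg: "degree (A w y) \<le> of_bool (w \<in> \<Phi>)" for w y
    by (auto simp: A_def of_bool_def)
  have A: "poly (A w y) r = op_kernel (\<lambda>w. a w + r * b w) w y" if "w \<in> \<Gamma>" for w y r
    using that b[of w] by (auto simp: A_def op_kernel_def algebra_simps)
  have eq: "(a w + r * b w) * poly (p w) r - hop \<Gamma> (\<lambda>w. poly (p w) r) w = of_bool (w = v) * poly q r"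
    if w: "w \<in> \<Gamma>" for w r
  proof -
    have "poly (\<Sum>y\<in>\<Gamma>. A w y * p y) r = poly (of_bool (w = v) * q) r"
      unfolding p_def q_def by (subst kadj_right[OF \<Gamma> w v']) simp
    then have "(\<Sum>y\<in>\<Gamma>. op_kernel (\<lambda>w. a w + r * b w) w y * poly (p y) r) = of_bool (w = v) * poly q r"
      by (simp add: poly_sum A w)
    then show ?thesis
      by (simp add: sum_op_kernel \<Gamma> w)
  qed
  show ?thesis
  proof (rule exI[of _ "p x"], rule exI[of _ q], intro conjI allI impI)
    show "degree (p x) \<le> card \<Phi>" "degree q \<le> card \<Phi>"
      unfolding p_def q_def using degree_kdet_le[OF \<Gamma> \<Phi>, of A, OF deg] x' v' by auto
    fix r
    show "\<exists>\<psi>. \<psi> x = poly (p x) r \<and>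
      (\<forall>w\<in>\<Gamma>. (a w + r * b w) * \<psi> w - hop \<Gamma> \<psi> w = of_bool (w = v) * poly q r)"
      using eq by (intro exI[of _ "\<lambda>w. poly (p w) r"]) simp
  next
    fix r and e :: real assume e: "e \<noteq> 0" "\<forall>w\<in>\<Gamma>. Im (a w + r * b w) = e"
    have "kdet \<Gamma> (\<lambda>w y. poly (A w y) r) = kdet \<Gamma> (op_kernel (\<lambda>w. a w + r * b w))"
      unfolding kdet_def
      by (rule arg_cong[where f = Determinant.det], rule eq_matI)
        (auto simp: kmat_def intro!: A bij_betwE[OF bij_from_nat_into[OF \<Gamma>], rule_format])
    then show q: "poly q r \<noteq> 0"
      using kdet_op_kernel_nonzero[OF \<Gamma>, of "\<lambda>w. a w + r * b w" e] e by (simp add: q_def poly_kdet)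
    show "gf \<Gamma> (\<lambda>w. a w + r * b w) x v = poly (p x) r / poly q r"
    proof (rule gf_unique[OF \<Gamma> _ e(1) v' x'])
      fix w assume w: "w \<in> \<Gamma>"
      have "hop \<Gamma> (\<lambda>w. poly (p w) r / poly q r) w = hop \<Gamma> (\<lambda>w. poly (p w) r) w / poly q r"
        by (simp add: hop_def sum_divide_distrib)
      then show "(a w + r * b w) * (poly (p w) r / poly q r) - hop \<Gamma> (\<lambda>w. poly (p w) r / poly q r) w =
          of_bool (w = v)"
        using eq[OF w, of r] q by (simp add: field_simps)
    qed (use e in auto)
  qed
qed

lemma measurable_gf:
  assumes \<Gamma>: "finite \<Gamma>" and a: "\<And>x. (\<lambda>\<omega>. a \<omega> x) \<in> borel_measurable M"
  shows "(\<lambda>\<omega>. gf \<Gamma> (a \<omega>) x y) \<in> borel_measurable M"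
proof (cases "x \<in> \<Gamma> \<and> y \<in> \<Gamma>")
  case True
  have "(\<lambda>\<omega>. op_kernel (a \<omega>) w w') \<in> borel_measurable M" for w w'
    unfolding op_kernel_def using a by measurable
  then have "(\<lambda>\<omega>. kdet \<Gamma> (op_kernel (a \<omega>))) \<in> borel_measurable M"
    "(\<lambda>\<omega>. kadj \<Gamma> (op_kernel (a \<omega>)) x y) \<in> borel_measurable M"
    using measurable_kdet[OF \<Gamma>, of "\<lambda>\<omega>. op_kernel (a \<omega>)" M] True by auto
  then show ?thesis
    using True by (simp add: gf_def borel_measurable_divide)
next
  case False
  then have "gf \<Gamma> (a \<omega>) x y = 0" for \<omega>
    by (auto simp: gf_def)
  then show ?thesis by simp
qed

end

section \<open>Rational functions of a random variable with bounded density\<close>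

text \<open>Lagrange interpolation at \<open>n + 1\<close> points. Mutual distances of at least one
  keep the denominators harmless, so every basis polynomial is at most \<open>L ^ n\<close> at
  \<open>r\<close>.\<close>

lemma poly_bound_by_interpolation:
  fixes p :: "complex poly" and \<xi> :: "nat \<Rightarrow> complex"
  assumes deg: "degree p \<le> n"
    and sep: "\<And>i j. i \<le> n \<Longrightarrow> j \<le> n \<Longrightarrow> i \<noteq> j \<Longrightarrow> 1 \<le> cmod (\<xi> i - \<xi> j)"
    and L: "\<And>i. i \<le> n \<Longrightarrow> cmod (r - \<xi> i) \<le> L"
  shows "cmod (poly p r) \<le> (\<Sum>j\<le>n. cmod (poly p (\<xi> j))) * L ^ n"
proof -
  define l where "l j = (\<Prod>i\<in>{..n} - {j}. Polynomial.smult (1 / (\<xi> j - \<xi> i)) [:- \<xi> i, 1:])" for j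
  have l: "poly (l j) x = (\<Prod>i\<in>{..n} - {j}. (x - \<xi> i) / (\<xi> j - \<xi> i))" for j x
    unfolding l_def poly_prod by (intro prod.cong) (auto simp: diff_divide_distrib)
  have inj: "\<xi> i \<noteq> \<xi> j" if "i \<le> n" "j \<le> n" "i \<noteq> j" for i j
    using sep[OF that] by auto
  \<comment> \<open>Both sides have degree at most \<open>n\<close> and agree at the
    \<open>n + 1\<close> distinct nodes.\<close>
  have "p = (\<Sum>j\<le>n. Polynomial.smult (poly p (\<xi> j)) (l j))"
  proof (rule poly_eqI_degree)
    have "card (\<xi> ` {..n}) = Suc n"
      using inj by (subst card_image) (auto simp: inj_on_def)
    moreover have "degree (\<Sum>j\<le>n. Polynomial.smult (poly p (\<xi> j)) (l j)) \<le> n"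
    proof (intro degree_sum_le)
      fix j assume j: "j \<in> {..n}"
      have "degree (l j) \<le> (\<Sum>i\<in>{..n} - {j}. degree (Polynomial.smult (1 / (\<xi> j - \<xi> i)) [:- \<xi> i, 1:]))"
        unfolding l_def
        using degree_prod_sum_le[of "{..n} - {j}" "\<lambda>i. Polynomial.smult (1 / (\<xi> j - \<xi> i)) [:- \<xi> i, 1:]"]
        by (simp only: o_def finite_atMost finite_Diff)
      also have "\<dots> \<le> (\<Sum>i\<in>{..n} - {j}. 1)"
        by (intro sum_mono) auto
      finally show "degree (Polynomial.smult (poly p (\<xi> j)) (l j)) \<le> n"
        using j by (auto intro: order_trans[OF degree_smult_le])
    qed simp
    ultimately show "degree p < card (\<xi> ` {..n})"
      "degree (\<Sum>j\<le>n. Polynomial.smult (poly p (\<xi> j)) (l j)) < card (\<xi> ` {..n})"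
      using deg by auto
    fix x assume "x \<in> \<xi> ` {..n}"
    then obtain k where k: "k \<le> n" "x = \<xi> k" by auto
    have "poly (l j) x = of_bool (j = k)" if "j \<le> n" for j
    proof (cases "j = k")
      case True
      then show ?thesis
        unfolding l k(2) using inj k(1) by (auto intro!: prod.neutral)
    next
      case False
      then show ?thesis
        unfolding l k(2) using k(1) by (auto intro!: prod_zero)
    qed
    then have "(\<Sum>j\<le>n. poly p (\<xi> j) * poly (l j) x) = (\<Sum>j\<le>n. if j = k then poly p (\<xi> j) else 0)"
      by (intro sum.cong) auto
    then show "poly p x = poly (\<Sum>j\<le>n. Polynomial.smult (poly p (\<xi> j)) (l j)) x"
      using k by (simp add: poly_sum)
  qed
  then have "poly p r = (\<Sum>j\<le>n. poly p (\<xi> j) * poly (l j) r)"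
    by (metis (no_types, lifting) poly_smult poly_sum sum.cong)
  also have "cmod \<dots> \<le> (\<Sum>j\<le>n. cmod (poly p (\<xi> j)) * L ^ n)"
  proof (rule sum_norm_le)
    fix j assume j: "j \<in> {..n}"
    have "cmod (poly (l j) r) = (\<Prod>i\<in>{..n} - {j}. cmod (r - \<xi> i) / cmod (\<xi> j - \<xi> i))"
      unfolding l by (simp add: norm_divide flip: prod_norm)
    also have "\<dots> \<le> (\<Prod>i\<in>{..n} - {j}. L)"
    proof (intro prod_mono conjI)
      fix i assume i: "i \<in> {..n} - {j}"
      have "cmod (r - \<xi> i) / cmod (\<xi> j - \<xi> i) \<le> cmod (r - \<xi> i)"
        using sep[of j i] i j by (intro divide_left_mono[of 1, simplified]) auto
      also have "\<dots> \<le> L" using L[of i] i by auto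
      finally show "cmod (r - \<xi> i) / cmod (\<xi> j - \<xi> i) \<le> L" .
    qed auto
    also have "\<dots> = L ^ n" using j by simp
    finally show "cmod (poly p (\<xi> j) * poly (l j) r) \<le> cmod (poly p (\<xi> j)) * L ^ n"
      by (simp add: norm_mult mult_left_mono)
  qed
  finally show ?thesis
    by (simp add: sum_distrib_right)
qed

lemma complex_poly_factors:
  fixes q :: "complex poly"
  assumes "q \<noteq> 0"
  obtains b :: "nat \<Rightarrow> complex" where "\<And>x. poly q x = lead_coeff q * (\<Prod>i<degree q. x - b i)"
proof -
  obtain A where A: "size A = degree q" "q = Polynomial.smult (lead_coeff q) (\<Prod>x\<in>#A. [:-x, 1:])"
    using alg_closed_imp_factorization[OF assms] by auto
  obtain xs where xs: "mset xs = A"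
    using ex_mset by auto
  have len: "length xs = degree q"
    using A(1) xs by auto
  have "poly q x = lead_coeff q * (\<Prod>i<degree q. x - xs ! i)" for x
  proof -
    have "(\<Prod>x\<in>#A. [:-x, 1:]) = (\<Prod>i<degree q. [:- xs ! i, 1:])"
      unfolding xs[symmetric] mset_map[symmetric] prod_mset_prod_list prod.list_conv_set_nth
      by (simp add: len atLeast0LessThan)
    then show ?thesis
      by (subst A(2)) (simp add: poly_prod)
  qed
  then show thesis by (rule that)
qed

text \<open>Interpolation bounds \<open>p\<close> at \<open>r\<close> by values of \<open>q\<close>
  at the nodes, and these are compared with \<open>q\<close> at \<open>r\<close> zero by zero:
  \<open>cmod (\<xi> j - b i) \<le> cmod (r - b i) + L\<close>. The zeros are chosen before
  \<open>r\<close>, so that the bound can afterwards be integrated over \<open>r\<close>.\<close>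

lemma rational_bound:
  fixes p q :: "complex poly" and \<xi> :: "nat \<Rightarrow> complex"
  assumes q: "q \<noteq> 0" "degree q \<le> n" and p: "degree p \<le> n"
    and sep: "\<And>i j. i \<le> n \<Longrightarrow> j \<le> n \<Longrightarrow> i \<noteq> j \<Longrightarrow> 1 \<le> cmod (\<xi> i - \<xi> j)"
    and B: "\<And>j. j \<le> n \<Longrightarrow> cmod (poly p (\<xi> j)) \<le> B * cmod (poly q (\<xi> j))" "0 \<le> B"
  shows "\<exists>b m. m \<le> n \<and> (\<forall>r L. (\<forall>i\<le>n. cmod (r - \<xi> i) \<le> L) \<longrightarrow> poly q r \<noteq> 0 \<longrightarrow>
    cmod (poly p r / poly q r) \<le> B * (real (n + 1) * L ^ n) * (\<Prod>i<m. 1 + L / cmod (r - b i)))"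
proof -
  obtain b where b: "\<And>x. poly q x = lead_coeff q * (\<Prod>i<degree q. x - b i)"
    using complex_poly_factors[OF q(1)] by blast
  show ?thesis
  proof (intro exI[of _ b] exI[of _ "degree q"] conjI allI impI q(2))
    fix r L
    assume "\<forall>i\<le>n. cmod (r - \<xi> i) \<le> L" and r: "poly q r \<noteq> 0"
    then have L: "\<And>i. i \<le> n \<Longrightarrow> cmod (r - \<xi> i) \<le> L" by simp
    have L0: "0 \<le> L"
      using L[of 0] norm_ge_zero order_trans by blast
    let ?P = "\<Prod>i<degree q. 1 + L / cmod (r - b i)"
    have rb: "r \<noteq> b i" if "i < degree q" for i
      using r that by (auto simp: b)
    have "cmod (poly q (\<xi> j)) \<le> ?P * cmod (poly q r)" if "j \<le> n" for j
    proof -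
      have "(\<Prod>i<degree q. cmod (\<xi> j - b i)) \<le> (\<Prod>i<degree q. (1 + L / cmod (r - b i)) * cmod (r - b i))"
      proof (intro prod_mono conjI)
        fix i assume "i \<in> {..<degree q}"
        then have "(1 + L / cmod (r - b i)) * cmod (r - b i) = cmod (r - b i) + L"
          using rb[of i] by (simp add: distrib_right)
        moreover have "cmod (\<xi> j - b i) \<le> cmod (r - b i) + cmod (r - \<xi> j)"
          using norm_triangle_ineq4[of "r - b i" "r - \<xi> j"] by simp
        ultimately show "cmod (\<xi> j - b i) \<le> (1 + L / cmod (r - b i)) * cmod (r - b i)"
          using L[OF that] by simp
      qed auto
      then have "cmod (lead_coeff q) * (\<Prod>i<degree q. cmod (\<xi> j - b i)) \<le>
          cmod (lead_coeff q) * (?P * (\<Prod>i<degree q. cmod (r - b i)))"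
        by (intro mult_left_mono) (auto simp: prod.distrib)
      then show ?thesis
        by (simp add: b[of r] b[of "\<xi> j"] norm_mult mult_ac flip: prod_norm)
    qed
    then have "(\<Sum>j\<le>n. cmod (poly p (\<xi> j))) \<le> (\<Sum>j\<le>n. B * (?P * cmod (poly q r)))"
      using B by (intro sum_mono order_trans[OF B(1)] mult_left_mono) auto
    then have "cmod (poly p r) \<le> (\<Sum>j\<le>n. B * (?P * cmod (poly q r))) * L ^ n"
      using poly_bound_by_interpolation[of p n \<xi> r L, OF p sep L] L0
      by (meson mult_right_mono order_trans zero_le_power)
    then show "cmod (poly p r / poly q r) \<le> B * (real (n + 1) * L ^ n) * ?P"
      using r by (simp add: norm_divide divide_le_eq mult_ac)
  qed
qed

section \<open>Fractional powers and integrable singularities\<close>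

text \<open>A number in the unit interval is at most its power of order
  \<open>\<kappa> \<le> 1\<close>; apply this to the two fractions \<open>a / (a + b)\<close> and
  \<open>b / (a + b)\<close>.\<close>

lemma powr_add_le:
  fixes a b \<kappa> :: real
  assumes "0 \<le> a" "0 \<le> b" "0 < \<kappa>" "\<kappa> \<le> 1"
  shows "(a + b) powr \<kappa> \<le> a powr \<kappa> + b powr \<kappa>"
proof (cases "a + b = 0")
  case False
  let ?s = "a + b"
  have s: "0 < ?s" using False assms by simp
  have le: "c / ?s * ?s powr \<kappa> \<le> c powr \<kappa>" if "0 \<le> c" "c \<le> ?s" for c
  proof (cases "c = 0")
    case False
    have "(c / ?s) powr 1 \<le> (c / ?s) powr \<kappa>"
      using that False s assms by (intro powr_mono') auto
    then have "c / ?s * ?s powr \<kappa> \<le> (c / ?s) powr \<kappa> * ?s powr \<kappa>"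
      using that s by (intro mult_right_mono) auto
    then show ?thesis
      using that s by (simp add: powr_divide)
  qed simp
  have "?s powr \<kappa> = a / ?s * ?s powr \<kappa> + b / ?s * ?s powr \<kappa>"
    using s by (simp flip: distrib_right add_divide_distrib)
  also have "\<dots> \<le> a powr \<kappa> + b powr \<kappa>"
    using assms by (intro add_mono le) auto
  finally show ?thesis .
qed (use assms in auto)

lemma powr_sum_le:
  fixes f :: "'i \<Rightarrow> real"
  assumes "\<And>i. i \<in> S \<Longrightarrow> 0 \<le> f i" "0 < \<kappa>" "\<kappa> \<le> 1"
  shows "(\<Sum>i\<in>S. f i) powr \<kappa> \<le> (\<Sum>i\<in>S. f i powr \<kappa>)"
  using assms(1)
proof (induction S rule: infinite_finite_induct)
  case (insert x S)
  have "(f x + (\<Sum>i\<in>S. f i)) powr \<kappa> \<le> f x powr \<kappa> + (\<Sum>i\<in>S. f i) powr \<kappa>"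
    using insert.prems assms by (intro powr_add_le sum_nonneg) auto
  then show ?case
    using insert by auto
qed auto

text \<open>The product is at most the \<open>n\<close>-th power of its largest factor. This
  separates the singularities of a product, at the price of the exponent \<open>n * \<tau>\<close>,
  which must stay below one for integrability.\<close>

lemma prod_powr_le_sum_powr:
  fixes t :: "nat \<Rightarrow> real"
  assumes t: "\<And>i. i < m \<Longrightarrow> 1 \<le> t i" and m: "m \<le> n" and \<tau>: "0 \<le> \<tau>"
  shows "(\<Prod>i<m. t i) powr \<tau> \<le> 1 + (\<Sum>i<m. t i powr (real n * \<tau>))"
proof (cases "m = 0")
  case False
  define M where "M = Max (t ` {..<m})"
  have "M \<in> t ` {..<m}"
    unfolding M_def using False by (intro Max_in) auto
  then obtain k where k: "k < m" "t k = M" by auto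
  have le: "t i \<le> M" if "i < m" for i
    unfolding M_def using that by simp
  have M1: "1 \<le> M" using t[OF k(1)] k by simp
  have "(\<Prod>i<m. t i) \<le> (\<Prod>i<m. M)"
    using t le by (intro prod_mono) (auto intro: order_trans[of 0 1])
  also have "\<dots> \<le> M ^ n"
    using M1 m by (simp add: power_increasing)
  also have "\<dots> = M powr real n"
    using M1 by (simp add: powr_realpow)
  finally have "(\<Prod>i<m. t i) powr \<tau> \<le> (M powr real n) powr \<tau>"
    using t \<tau> by (intro powr_mono2) (auto intro!: prod_nonneg intro: order_trans[of 0 1])
  also have "\<dots> = t k powr (real n * \<tau>)"
    by (simp add: powr_powr k)
  also have "\<dots> \<le> (\<Sum>i<m. t i powr (real n * \<tau>))"
    using k by (intro member_le_sum[of k _ "\<lambda>i. t i powr (real n * \<tau>)"]) auto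
  finally show ?thesis by simp
qed simp

lemma nn_integral_powr_unit:
  assumes "0 \<le> \<kappa>" "\<kappa> < 1"
  shows "(\<integral>\<^sup>+ t. ennreal (indicator {0..1} t * t powr - \<kappa>) \<partial>lborel) = ennreal (1 / (1 - \<kappa>))"
proof -
  have "((\<lambda>t. t powr - \<kappa>) has_integral (1 powr (- \<kappa> + 1) / (- \<kappa> + 1))) {0..1}"
    using assms by (intro has_integral_powr_from_0) auto
  then have "((\<lambda>t. t powr - \<kappa>) has_integral (1 / (1 - \<kappa>))) {0..1}"
    by simp
  from nn_integral_has_integral_lebesgue[OF _ this] show ?thesis
    by simp
qed

lemma nn_integral_singularity:
  fixes a \<kappa> :: real
  assumes "0 \<le> \<kappa>" "\<kappa> < 1"
  shows "(\<integral>\<^sup>+ t. ennreal (indicator {a - 1..a + 1} t * \<bar>t - a\<bar> powr - \<kappa>) \<partial>lborel) \<le> ennreal (2 / (1 - \<kappa>))"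
proof -
  let ?g = "\<lambda>t::real. ennreal (indicator {0..1} t * t powr - \<kappa>)"
  have [measurable]: "?g \<in> borel_measurable borel" by measurable
  have "(\<integral>\<^sup>+ t. ennreal (indicator {a - 1..a + 1} t * \<bar>t - a\<bar> powr - \<kappa>) \<partial>lborel) =
      (\<integral>\<^sup>+ t. ennreal (indicator {a - 1..a + 1} (a + 1 * t) * \<bar>(a + 1 * t) - a\<bar> powr - \<kappa>) \<partial>lborel)"
    by (subst nn_integral_real_affine[where c = 1 and t = a]) auto
  \<comment> \<open>After translation to the origin, the two half-intervals are reflections of each
    other.\<close>
  also have "\<dots> \<le> (\<integral>\<^sup>+ t. ?g t + ?g (0 + (- 1) * t) \<partial>lborel)"
    by (intro nn_integral_mono) (auto simp: indicator_def abs_if)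
  also have "\<dots> = (\<integral>\<^sup>+ t. ?g t \<partial>lborel) + (\<integral>\<^sup>+ t. ?g (0 + (- 1) * t) \<partial>lborel)"
    by (intro nn_integral_add) measurable
  also have "(\<integral>\<^sup>+ t. ?g (0 + (- 1) * t) \<partial>lborel) = (\<integral>\<^sup>+ t. ?g t \<partial>lborel)"
    using nn_integral_real_affine[of ?g "- 1" 0] by simp
  also have "(\<integral>\<^sup>+ t. ?g t \<partial>lborel) = ennreal (1 / (1 - \<kappa>))"
    using assms by (rule nn_integral_powr_unit)
  also have "ennreal (1 / (1 - \<kappa>)) + ennreal (1 / (1 - \<kappa>)) = ennreal (2 / (1 - \<kappa>))"
    using assms by (simp flip: ennreal_plus)
  finally show ?thesis .
qed

section \<open>Single-site distributions with bounded density and bounded support\<close>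

locale bounded_density = prob_space \<nu> for \<nu> :: "real measure" +
  fixes C\<^sub>0 R\<^sub>0 :: real
  assumes sets_eq [measurable_cong, simp]: "sets \<nu> = sets borel"
    and C\<^sub>0: "0 \<le> C\<^sub>0"
    and dominated: "f \<in> borel_measurable borel \<Longrightarrow>
      (\<integral>\<^sup>+ t. f t \<partial>\<nu>) \<le> ennreal C\<^sub>0 * (\<integral>\<^sup>+ t. f t \<partial>lborel)"
    and bounded: "AE t in \<nu>. \<bar>t\<bar> \<le> R\<^sub>0"
begin

lemma AE_not_eq: "AE t in \<nu>. t \<noteq> a"
proof (rule AE_I[of _ _ "{a}"])
  have "emeasure \<nu> {a} = (\<integral>\<^sup>+ t. indicator {a} t \<partial>\<nu>)"
    by (simp add: nn_integral_indicator)
  also have "\<dots> \<le> ennreal C\<^sub>0 * (\<integral>\<^sup>+ t. indicator {a} t \<partial>lborel)"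
    by (rule dominated) simp
  finally show "emeasure \<nu> {a} = 0" by simp
qed auto

text \<open>The distance from a real \<open>t\<close> to \<open>b\<close> is at least
  \<open>\<bar>t - Re b\<bar>\<close>. The resulting singularity is integrable for
  \<open>\<kappa> < 1\<close> against Lebesgue measure near \<open>Re b\<close>, and the power is at
  most one elsewhere.\<close>

lemma singularity_moment:
  fixes b :: complex
  assumes \<kappa>: "0 < \<kappa>" "\<kappa> < 1" and L: "0 \<le> L"
  shows "(\<integral>\<^sup>+ t. ennreal ((1 + L / cmod (of_real t - b)) powr \<kappa>) \<partial>\<nu>) \<le>
    ennreal (1 + L powr \<kappa> * (1 + C\<^sub>0 * (2 / (1 - \<kappa>))))"
proof -
  let ?a = "Re b"
  let ?h = "\<lambda>t. indicator {?a - 1..?a + 1} t * \<bar>t - ?a\<bar> powr - \<kappa>"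
  \<comment> \<open>The point \<open>t = ?a\<close> is excluded because
    \<open>0 powr - \<kappa>\<close> is \<open>0\<close>, so the right side gives no control there;
    it is a null set.\<close>
  have bound: "(1 + L / cmod (of_real t - b)) powr \<kappa> \<le> 1 + L powr \<kappa> * (1 + ?h t)" if "t \<noteq> ?a" for t
  proof -
    have pos: "0 < \<bar>t - ?a\<bar>" using that by simp
    have "\<bar>t - ?a\<bar> \<le> cmod (of_real t - b)"
      using abs_Re_le_cmod[of "of_real t - b"] by simp
    then have "L / cmod (of_real t - b) \<le> L / \<bar>t - ?a\<bar>"
      using L pos by (intro divide_left_mono mult_pos_pos) auto
    then have "(1 + L / cmod (of_real t - b)) powr \<kappa> \<le> (1 + L / \<bar>t - ?a\<bar>) powr \<kappa>"
      using \<kappa> L by (intro powr_mono2) auto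
    also have "\<dots> \<le> 1 powr \<kappa> + (L / \<bar>t - ?a\<bar>) powr \<kappa>"
      using \<kappa> L by (intro powr_add_le) auto
    also have "(L / \<bar>t - ?a\<bar>) powr \<kappa> = L powr \<kappa> * \<bar>t - ?a\<bar> powr - \<kappa>"
      using L by (simp add: powr_divide powr_minus_divide)
    also have "\<bar>t - ?a\<bar> powr - \<kappa> \<le> 1 + ?h t"
    proof (cases "\<bar>t - ?a\<bar> \<le> 1")
      case True
      then show ?thesis by (simp add: indicator_def abs_if split: if_splits)
    next
      case False
      then have "\<bar>t - ?a\<bar> powr - \<kappa> \<le> \<bar>t - ?a\<bar> powr 0"
        using \<kappa> by (intro powr_mono) auto
      also have "\<dots> \<le> 1 + ?h t" by simp
      finally show ?thesis .
    qed
    finally show ?thesis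
      by (simp add: mult_left_mono)
  qed
  have "(\<integral>\<^sup>+ t. ennreal ((1 + L / cmod (of_real t - b)) powr \<kappa>) \<partial>\<nu>) \<le>
      (\<integral>\<^sup>+ t. ennreal (1 + L powr \<kappa>) + ennreal (L powr \<kappa>) * ennreal (?h t) \<partial>\<nu>)"
  proof (rule nn_integral_mono_AE)
    show "AE t in \<nu>. ennreal ((1 + L / cmod (of_real t - b)) powr \<kappa>) \<le>
        ennreal (1 + L powr \<kappa>) + ennreal (L powr \<kappa>) * ennreal (?h t)"
      using AE_not_eq[of ?a]
    proof eventually_elim
      case (elim t)
      have eq: "ennreal (1 + L powr \<kappa>) + ennreal (L powr \<kappa>) * ennreal (?h t) = ennreal (1 + L powr \<kappa> * (1 + ?h t))"
        by (simp add: algebra_simps flip: ennreal_plus ennreal_mult')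
      show ?case
        unfolding eq by (rule ennreal_leI[OF bound[OF elim]])
    qed
  qed
  also have "\<dots> = ennreal (1 + L powr \<kappa>) + ennreal (L powr \<kappa>) * (\<integral>\<^sup>+ t. ennreal (?h t) \<partial>\<nu>)"
    by (subst nn_integral_add) (auto simp: nn_integral_cmult emeasure_space_1)
  also have "(\<integral>\<^sup>+ t. ennreal (?h t) \<partial>\<nu>) \<le> ennreal C\<^sub>0 * (\<integral>\<^sup>+ t. ennreal (?h t) \<partial>lborel)"
    by (rule dominated) measurable
  also have "(\<integral>\<^sup>+ t. ennreal (?h t) \<partial>lborel) \<le> ennreal (2 / (1 - \<kappa>))"
    using \<kappa> by (intro nn_integral_singularity) auto
  finally have "(\<integral>\<^sup>+ t. ennreal ((1 + L / cmod (of_real t - b)) powr \<kappa>) \<partial>\<nu>) \<le>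
      ennreal (1 + L powr \<kappa>) + ennreal (L powr \<kappa>) * (ennreal C\<^sub>0 * ennreal (2 / (1 - \<kappa>)))"
    by (simp add: add_left_mono mult_left_mono)
  also have "\<dots> = ennreal (1 + L powr \<kappa> * (1 + C\<^sub>0 * (2 / (1 - \<kappa>))))"
    using \<kappa> C\<^sub>0 by (simp add: algebra_simps flip: ennreal_plus ennreal_mult')
  finally show ?thesis .
qed

text \<open>Replacing one coordinate by an independent copy preserves the product measure. Working
  with updates of full configurations avoids splitting the configuration space in later
  arguments.\<close>

lemma nn_integral_resample:
  fixes F :: "('i \<Rightarrow> real) \<Rightarrow> ennreal"
  assumes F [measurable]: "F \<in> borel_measurable (\<Pi>\<^sub>M i\<in>UNIV. \<nu>)"
  shows "(\<integral>\<^sup>+ w. F w \<partial>(\<Pi>\<^sub>M i\<in>UNIV. \<nu>)) =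
    (\<integral>\<^sup>+ w. (\<integral>\<^sup>+ r. F (w(k := r)) \<partial>\<nu>) \<partial>(\<Pi>\<^sub>M i\<in>UNIV. \<nu>))"
proof -
  let ?P = "\<Pi>\<^sub>M i\<in>UNIV. \<nu>" and ?Q = "\<Pi>\<^sub>M i\<in>UNIV - {k}. \<nu>"
  have upd' [measurable]: "(\<lambda>z. (fst z)(k := snd z)) \<in> ?P \<Otimes>\<^sub>M \<nu> \<rightarrow>\<^sub>M ?P"
    by (rule measurable_fun_upd[where J = UNIV]) auto
  have "(\<lambda>(w, r). F (w(k := r))) \<in> borel_measurable (?P \<Otimes>\<^sub>M \<nu>)"
    unfolding case_prod_beta' by (rule measurable_compose[OF upd' F])
  then have meas: "(\<lambda>w. \<integral>\<^sup>+ r. F (w(k := r)) \<partial>\<nu>) \<in> borel_measurable ?P"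
    by (rule sigma_finite_measure.borel_measurable_nn_integral[OF sigma_finite_measure_axioms])
  interpret Q: prob_space ?Q
    by (intro prob_space_PiM) unfold_locales
  interpret pair_sigma_finite \<nu> ?Q ..
  have ins: "insert k (UNIV - {k}) = UNIV" by auto
  have upd [measurable]: "(\<lambda>(x, X). X(k := x)) \<in> \<nu> \<Otimes>\<^sub>M ?Q \<rightarrow>\<^sub>M ?P"
    unfolding case_prod_beta' by (rule measurable_fun_upd[where J = "UNIV - {k}"]) auto
  have distr: "distr (\<nu> \<Otimes>\<^sub>M ?Q) ?P (\<lambda>(x, X). X(k := x)) = ?P"
    using distr_pair_PiM_eq_PiM[of "UNIV - {k}" "\<lambda>_. \<nu>" k] prob_space_axioms by (simp add: ins)
  have split: "(\<integral>\<^sup>+ w. G w \<partial>?P) = (\<integral>\<^sup>+ X. (\<integral>\<^sup>+ x. G (X(k := x)) \<partial>\<nu>) \<partial>?Q)"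
    if [measurable]: "G \<in> borel_measurable ?P" for G
  proof -
    have "(\<integral>\<^sup>+ w. G w \<partial>?P) = (\<integral>\<^sup>+ w. G w \<partial>distr (\<nu> \<Otimes>\<^sub>M ?Q) ?P (\<lambda>(x, X). X(k := x)))"
      by (simp only: distr)
    also have "\<dots> = (\<integral>\<^sup>+ z. G ((\<lambda>(x, X). X(k := x)) z) \<partial>(\<nu> \<Otimes>\<^sub>M ?Q))"
      by (rule nn_integral_distr) measurable
    also have "\<dots> = (\<integral>\<^sup>+ X. (\<integral>\<^sup>+ x. G (X(k := x)) \<partial>\<nu>) \<partial>?Q)"
      by (subst nn_integral_snd[symmetric]) (auto simp: case_prod_beta')
    finally show ?thesis .
  qed
  have "(\<integral>\<^sup>+ w. (\<integral>\<^sup>+ r. F (w(k := r)) \<partial>\<nu>) \<partial>?P) =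
      (\<integral>\<^sup>+ X. (\<integral>\<^sup>+ x. (\<integral>\<^sup>+ r. F (X(k := r)) \<partial>\<nu>) \<partial>\<nu>) \<partial>?Q)"
    by (subst split[OF meas]) simp
  \<comment> \<open>The second update overwrites the first, so the integral over the first value is
    that of a constant against a probability measure.\<close>
  also have "\<dots> = (\<integral>\<^sup>+ X. (\<integral>\<^sup>+ r. F (X(k := r)) \<partial>\<nu>) \<partial>?Q)"
    by (simp add: emeasure_space_1)
  finally show ?thesis
    by (simp add: split[OF F])
qed

end

text \<open>The complement of the support is a union of open null sets. It may be an uncountable
  union, and the Lindelof property makes it a countable one, hence null.\<close>

lemma compact_support_bounded:
  assumes cpt: "compact (measure_support \<nu>)" and sets: "sets \<nu> = sets borel"
  obtains R where "AE t in \<nu>. \<bar>t\<bar> \<le> R"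
proof -
  let ?S = "measure_support \<nu>"
  obtain R where R: "\<And>t. t \<in> ?S \<Longrightarrow> \<bar>t\<bar> \<le> R"
    using compact_imp_bounded[OF cpt] by (auto simp: bounded_iff)
  let ?F = "{U. open U \<and> emeasure \<nu> U = 0}"
  obtain F' where F': "F' \<subseteq> ?F" "countable F'" "\<Union>F' = \<Union>?F"
    using Lindelof[of ?F] by auto
  have "emeasure \<nu> (\<Union>F') = 0"
  proof -
    have "(\<Union>U\<in>F'. U) \<in> null_sets \<nu>"
      using F' by (intro null_sets_UN') (auto simp: null_sets_def sets)
    then show ?thesis by auto
  qed
  moreover have "{t. \<not> \<bar>t\<bar> \<le> R} \<subseteq> \<Union>F'"
    unfolding F'(3) using R by (fastforce simp: measure_support_def not_gr_zero)
  moreover have "\<Union>F' \<in> sets \<nu>"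
    using F' by (auto simp: sets intro!: borel_open open_Union)
  ultimately have "AE t in \<nu>. \<bar>t\<bar> \<le> R"
    by (intro AE_I[of _ _ "\<Union>F'"]) auto
  then show thesis by (rule that)
qed

section \<open>The alloy-type potential and conditional moments\<close>

lemma norm_max_le_iff: "norm_max x \<le> c \<longleftrightarrow> (\<forall>i. \<bar>vec_nth x i\<bar> \<le> c)"
  by (simp add: norm_max_def)

lemma component_le_norm_max: "\<bar>vec_nth x i\<bar> \<le> norm_max x"
  using norm_max_le_iff[of x "norm_max x"] by simp

lemma norm_max_nonneg: "0 \<le> norm_max x"
  using component_le_norm_max[of x undefined] by linarith

lemma norm_max_triangle: "norm_max (x + y) \<le> norm_max x + norm_max y"
  unfolding norm_max_le_iff
proof
  fix i show "\<bar>vec_nth (x + y) i\<bar> \<le> norm_max x + norm_max y"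
    using component_le_norm_max[of x i] component_le_norm_max[of y i] by simp
qed

lemma norm_max_minus: "norm_max (- x) = norm_max x"
  by (simp add: norm_max_def)

lemma norm_one_minus: "norm_one (- x) = norm_one x"
  by (simp add: norm_one_def)

lemma norm_max_le_norm_one: "norm_max x \<le> norm_one x"
  unfolding norm_max_le_iff norm_one_def
  using member_le_sum[of _ UNIV "\<lambda>i. \<bar>vec_nth x i\<bar>"] by simp

lemma card_norm_one_sphere: "card {e :: int ^ 'd. norm_one e = 1} \<le> 2 * CARD('d)"
proof -
  let ?f = "\<lambda>(i :: 'd, s :: int). axis i s"
  have "{e :: int ^ 'd. norm_one e = 1} \<subseteq> ?f ` (UNIV \<times> {- 1, 1})"
  proof
    fix e :: "int ^ 'd" assume "e \<in> {e. norm_one e = 1}"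
    then have e: "(\<Sum>i\<in>UNIV. \<bar>vec_nth e i\<bar>) = 1" by (simp add: norm_one_def)
    then obtain i where i: "vec_nth e i \<noteq> 0"
      by (metis (no_types, lifting) abs_0 sum.neutral zero_neq_one)
    have split: "\<bar>vec_nth e i\<bar> + (\<Sum>j\<in>UNIV - {i}. \<bar>vec_nth e j\<bar>) = 1"
      using e by (simp add: sum.remove[of UNIV i])
    moreover have nonneg: "0 \<le> (\<Sum>j\<in>UNIV - {i}. \<bar>vec_nth e j\<bar>)" by (simp add: sum_nonneg)
    ultimately have "\<bar>vec_nth e i\<bar> = 1" "(\<Sum>j\<in>UNIV - {i}. \<bar>vec_nth e j\<bar>) = 0"
      using i by linarith+
    then have "\<forall>j. j \<noteq> i \<longrightarrow> vec_nth e j = 0"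
      by (subst (asm) sum_nonneg_eq_0_iff) auto
    then have "e = axis i (vec_nth e i)"
      by (auto simp: Finite_Cartesian_Product.vec_eq_iff axis_def)
    moreover have "vec_nth e i = 1 \<or> vec_nth e i = - 1"
      using \<open>\<bar>vec_nth e i\<bar> = 1\<close> by linarith
    ultimately show "e \<in> ?f ` (UNIV \<times> {- 1, 1})" by force
  qed
  then have "card {e :: int ^ 'd. norm_one e = 1} \<le> card (?f ` (UNIV \<times> {- 1, 1}))"
    by (intro card_mono) auto
  also have "\<dots> \<le> card ((UNIV :: 'd set) \<times> {- 1, 1 :: int})"
    by (intro card_image_le) auto
  finally show ?thesis by (simp add: card_cartesian_product)
qed

definition nb :: "int ^ 'd \<Rightarrow> int ^ 'd \<Rightarrow> bool" where
  "nb x y \<longleftrightarrow> norm_one (x - y) = 1"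

lemma nbrs_eq: "{y. nb x y} = (\<lambda>e. x + e) ` {e. norm_one e = 1}"
proof -
  have "y \<in> (\<lambda>e. x + e) ` {e. norm_one e = 1}" if "nb x y" for y
    using that norm_one_minus[of "x - y"] by (intro image_eqI[of _ _ "y - x"]) (auto simp: nb_def)
  moreover have "nb x (x + e)" if "norm_one e = 1" for e
    using that norm_one_minus[of e] by (simp add: nb_def)
  ultimately show ?thesis by auto
qed

interpretation lat: hopping "nb :: int ^ 'd \<Rightarrow> int ^ 'd \<Rightarrow> bool" "2 * CARD('d)"
proof
  fix x y :: "int ^ 'd"
  show "nb x y \<longleftrightarrow> nb y x"
    using norm_one_minus[of "x - y"] by (simp add: nb_def)
  show "finite {y. nb x y}"
    by (simp add: nbrs_eq finite_norm_one_sphere)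
  have "card {y. nb x y} \<le> card {e :: int ^ 'd. norm_one e = 1}"
    unfolding nbrs_eq by (rule card_image_le) (rule finite_norm_one_sphere)
  then show "card {y. nb x y} \<le> 2 * CARD('d)"
    using card_norm_one_sphere by (rule order_trans)
qed

lemma laplacian_nbrs: "laplacian \<psi> x = (\<Sum>y | nb x y. \<psi> y)"
  unfolding laplacian_def nbrs_eq by (subst sum.reindex) (auto simp: inj_on_def)

lemma laplacian_eq_hop:
  assumes "finite \<Gamma>" "\<And>y. y \<notin> \<Gamma> \<Longrightarrow> \<psi> y = 0"
  shows "laplacian \<psi> x = lat.hop \<Gamma> \<psi> x"
  unfolding laplacian_nbrs lat.hop_nbrs[OF assms(1)]
  using assms lat.finite_nbrs by (intro sum.mono_neutral_right) auto

text \<open>A site outside the interior boundary has at least \<open>2 * CARD('d)\<close> neighbours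
  in the set, and a lattice site has no more than that altogether.\<close>

lemma nbrs_of_interior:
  fixes \<Theta> :: "(int ^ 'd) set"
  assumes "finite \<Theta>" "k \<in> \<Theta>" "k \<notin> interior_boundary \<Theta>" "nb k j"
  shows "j \<in> \<Theta>"
proof -
  have "2 * CARD('d) \<le> card {j \<in> \<Theta>. nb k j}"
    using assms by (simp add: interior_boundary_def nb_def)
  then have "card {j. nb k j} \<le> card {j \<in> \<Theta>. nb k j}"
    using lat.card_nbrs[of k] by simp
  then have "{j \<in> \<Theta>. nb k j} = {j. nb k j}"
    using lat.finite_nbrs by (intro card_seteq) auto
  with assms(4) show ?thesis by auto
qed

lemma alloy_potential_sum:
  assumes "finite (supp u)"
  shows "alloy_potential u w x = (\<Sum>j\<in>supp u. w (x - j) * u j)"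
proof -
  have "alloy_potential u w x = (\<Sum>\<^sub>\<infinity>k\<in>(\<lambda>j. x - j) ` supp u. w k * u (x - k))"
    unfolding alloy_potential_def
  proof (rule infsum_cong_neutral)
    fix k assume "k \<in> UNIV - (\<lambda>j. x - j) ` supp u"
    then have "x - k \<notin> supp u"
      by (metis DiffD2 diff_diff_eq2 add_diff_cancel_left' image_eqI)
    then show "w k * u (x - k) = 0" by (simp add: supp_def)
  qed auto
  also have "\<dots> = (\<Sum>j\<in>supp u. w (x - j) * u j)"
    using assms by (simp add: sum.reindex inj_on_def)
  finally show ?thesis .
qed

text \<open>The potential is affine in each coupling, which is what makes the Green function
  rational in it.\<close>

lemma alloy_potential_update:
  assumes "finite (supp u)"
  shows "alloy_potential u (w(k := r)) x = alloy_potential u (w(k := 0)) x + r * u (x - k)"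
proof -
  have eq: "(w(k := r)) (x - j) * u j = (w(k := 0)) (x - j) * u j + (if j = x - k then r * u j else 0)" for j
    by (auto simp: fun_upd_def)
  have "(\<Sum>j\<in>supp u. (w(k := r)) (x - j) * u j) =
      (\<Sum>j\<in>supp u. (w(k := 0)) (x - j) * u j) + (\<Sum>j\<in>supp u. if j = x - k then r * u j else 0)"
    unfolding eq sum.distrib ..
  also have "(\<Sum>j\<in>supp u. if j = x - k then r * u j else 0) = r * u (x - k)"
    using assms by (auto simp: supp_def)
  finally show ?thesis
    by (simp only: alloy_potential_sum[OF assms])
qed

lemma abs_alloy_potential_le:
  assumes "finite (supp u)" "\<And>j. \<bar>w j\<bar> \<le> R"
  shows "\<bar>alloy_potential u w x\<bar> \<le> R * (\<Sum>j\<in>supp u. \<bar>u j\<bar>)"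
proof -
  have "\<bar>alloy_potential u w x\<bar> \<le> (\<Sum>j\<in>supp u. \<bar>w (x - j) * u j\<bar>)"
    unfolding alloy_potential_sum[OF assms(1)] by (rule sum_abs)
  also have "\<dots> \<le> (\<Sum>j\<in>supp u. R * \<bar>u j\<bar>)"
    using assms(2) by (intro sum_mono) (auto simp: abs_mult mult_right_mono)
  finally show ?thesis by (simp add: sum_distrib_left)
qed

text \<open>This is the diagonal part of the Hamiltonian minus \<open>z\<close>. With it,
  \<open>lat.gf \<Gamma>\<close> is the Green function of the alloy-type model in a finite volume,
  \<open>g\<close> being the disorder strength.\<close>

definition symbol :: "real \<Rightarrow> (int ^ 'd \<Rightarrow> real) \<Rightarrow> (int ^ 'd \<Rightarrow> real) \<Rightarrow> complex \<Rightarrow> int ^ 'd \<Rightarrow> complex" where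
  "symbol g u w z x = of_real (g * alloy_potential u w x) - z"

lemma Im_symbol [simp]: "Im (symbol g u w z x) = - Im z"
  by (simp add: symbol_def)

lemma measurable_alloy_potential:
  assumes "finite (supp u)" "sets \<nu> = sets borel"
  shows "(\<lambda>w. alloy_potential u w x) \<in> borel_measurable (\<Pi>\<^sub>M k\<in>UNIV. \<nu>)"
  unfolding alloy_potential_sum[OF assms(1)]
proof (intro borel_measurable_sum borel_measurable_times borel_measurable_const)
  fix j
  have "(\<lambda>w. w (x - j)) \<in> (\<Pi>\<^sub>M k\<in>UNIV. \<nu>) \<rightarrow>\<^sub>M \<nu>"
    by (rule measurable_component_singleton) simp
  then show "(\<lambda>w. w (x - j)) \<in> borel_measurable (\<Pi>\<^sub>M k\<in>UNIV. \<nu>)"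
    using measurable_cong_sets[OF refl assms(2)] by blast
qed

section \<open>Uniform bounds for the average over one coupling\<close>

locale alloy = bounded_density \<nu> C\<^sub>0 R\<^sub>0 for \<nu> :: "real measure" and C\<^sub>0 R\<^sub>0 +
  fixes u :: "int ^ 'd \<Rightarrow> real"
  assumes zero_in_supp: "0 \<in> supp u" and finite_supp: "finite (supp u)"
    and boundary_pos: "\<forall>k \<in> interior_boundary (supp u). u k > 0"
begin

abbreviation P :: "(int ^ 'd \<Rightarrow> real) measure" where "P \<equiv> \<Pi>\<^sub>M k\<in>UNIV. \<nu>"

definition n :: nat where "n = card (supp u)"
definition D :: nat where "D = 2 * CARD('d)"
definition u\<^sub>0 :: real where "u\<^sub>0 = Min ((\<lambda>k. \<bar>u k\<bar>) ` supp u)"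
text \<open>An upper bound for the absolute potential when all couplings are at most
  \<open>R\<^sub>0\<close> in absolute value.\<close>

definition W :: real where "W = R\<^sub>0 * (\<Sum>j\<in>supp u. \<bar>u j\<bar>)"
definition E\<^sub>0 :: real where "E\<^sub>0 = W + real D + 1"
text \<open>
  Energies with \<open>cmod z \<ge> E\<^sub>0 * g\<close> are at distance at least \<open>g\<close> from the spectrum. Below that threshold,
  \<open>T\<close> is the distance from the real axis at which a complex value of one coupling satisfies
  all hypotheses of \<open>block_bound\<close> with \<open>l = g\<close>.
\<close>

definition T :: real where "T = (real D * real n + 1 + real D + W + E\<^sub>0) / u\<^sub>0"

lemma n_pos: "0 < n"
  using zero_in_supp finite_supp by (auto simp: n_def card_gt_0_iff)

lemma u\<^sub>0_le: "k \<in> supp u \<Longrightarrow> u\<^sub>0 \<le> \<bar>u k\<bar>"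
  unfolding u\<^sub>0_def using finite_supp by simp

lemma u\<^sub>0_pos: "0 < u\<^sub>0"
  unfolding u\<^sub>0_def using zero_in_supp finite_supp by (subst Min_gr_iff) (auto simp: supp_def)

lemma R\<^sub>0_nonneg: "0 \<le> R\<^sub>0"
proof (rule ccontr)
  assume "\<not> 0 \<le> R\<^sub>0"
  then have "AE t in \<nu>. False"
    by (intro eventually_mono[OF bounded]) auto
  then show False by simp
qed

lemma W_nonneg: "0 \<le> W"
  unfolding W_def using R\<^sub>0_nonneg by (intro mult_nonneg_nonneg sum_nonneg) auto

lemma T_u\<^sub>0: "T * u\<^sub>0 = real D * real n + 1 + real D + W + E\<^sub>0"
  using u\<^sub>0_pos by (simp add: T_def)

lemma T_nonneg: "0 \<le> T"
  unfolding T_def using u\<^sub>0_pos W_nonneg by (intro divide_nonneg_nonneg) (auto simp: E\<^sub>0_def)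

text \<open>Far from the spectrum every diagonal entry has modulus at least \<open>D + g\<close>, so
  \<open>block_bound\<close> applies with the whole volume as block and every site counted as
  interior.\<close>

lemma gf_large_energy:
  assumes \<Gamma>: "finite \<Gamma>" "x \<in> \<Gamma>" "v \<in> \<Gamma>" and g: "1 \<le> g" and z: "Im z \<noteq> 0" "E\<^sub>0 * g \<le> cmod z"
    and w: "\<And>j. \<bar>w j\<bar> \<le> R\<^sub>0"
  shows "cmod (lat.gf \<Gamma> (symbol g u w z) x v) \<le> 1 / g"
proof -
  have "g * cmod (lat.gf \<Gamma> (symbol g u w z) x v) \<le> cmod 1"
  proof (rule lat.block_bound[where \<Gamma> = \<Gamma> and \<Phi> = \<Gamma> and I = \<Gamma> and v = v and s = 1
        and a = "symbol g u w z" and \<psi> = "\<lambda>x. lat.gf \<Gamma> (symbol g u w z) x v"])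
    fix y assume "y \<in> \<Gamma>"
    have "g * \<bar>alloy_potential u w y\<bar> \<le> g * W"
      using g abs_alloy_potential_le[of u w R\<^sub>0 y, OF finite_supp w] by (simp add: W_def)
    moreover have "cmod (symbol g u w z y) \<ge> cmod z - g * \<bar>alloy_potential u w y\<bar>"
      unfolding symbol_def using g norm_triangle_ineq3[of "of_real (g * alloy_potential u w y)" z]
      by (simp add: abs_mult norm_mult)
    moreover have "E\<^sub>0 * g = g * W + g * real D + g"
      by (simp add: E\<^sub>0_def algebra_simps)
    moreover have "real D \<le> g * real D"
      using g mult_right_mono[of 1 g "real D"] by simp
    ultimately show "real (2 * CARD('d)) + g \<le> cmod (symbol g u w z y)"
      unfolding D_def[symmetric] using z(2) by linarith
  qed (use \<Gamma> g z in \<open>auto simp: lat.gf_eq[where e = "- Im z"]\<close>)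
  then show ?thesis
    using g by (simp add: field_simps)
qed

text \<open>This bounds the distance from an admissible real coupling to any of the
  \<open>n + 1\<close> interpolation points, which have moduli \<open>T\<close>, ...,
  \<open>T + n\<close>. The next constant \<open>K\<close> is the interpolation factor it
  produces.\<close>

definition L :: real where "L = R\<^sub>0 + T + real n"
definition K :: real where "K = real (n + 1) * L ^ n"

lemma L_nonneg: "0 \<le> L"
  using R\<^sub>0_nonneg T_nonneg by (simp add: L_def)

lemma K_nonneg: "0 \<le> K"
  using L_nonneg by (simp add: K_def)

text \<open>The zeros \<open>b\<close> may depend on the volume, the energy and the other couplings,
  but neither their number bound \<open>n\<close> nor the constants \<open>K\<close> and
  \<open>L\<close> do; this is the source of all uniformity.\<close>

lemma gf_single_site:
  assumes \<Gamma>: "finite \<Gamma>" and x: "x \<in> \<Gamma>" "x - k \<in> supp u" and v: "v \<in> \<Gamma>" "v - k \<in> supp u"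
    and g: "1 \<le> g" and z: "Im z \<noteq> 0" "cmod z \<le> E\<^sub>0 * g"
    and w: "\<And>j. j \<noteq> k \<Longrightarrow> \<bar>w j\<bar> \<le> R\<^sub>0"
  shows "\<exists>m b. m \<le> n \<and> (\<forall>r. \<bar>r\<bar> \<le> R\<^sub>0 \<longrightarrow> cmod (lat.gf \<Gamma> (symbol g u (w(k := r)) z) x v) \<le>
    K / g * (\<Prod>i<m. 1 + L / cmod (of_real r - b i)))"
proof -
  \<comment> \<open>The block \<open>k + supp u\<close> may be cut by the boundary of the volume.
    Sites of \<open>I\<close> still have all their neighbours within the volume in the
    block.\<close>
  define \<Phi> where "\<Phi> = {y \<in> \<Gamma>. y - k \<in> supp u}"
  define I where "I = {y \<in> \<Phi>. y - k \<notin> interior_boundary (supp u)}"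
  define a where "a = symbol g u (w(k := 0)) z"
  define b where "b y = complex_of_real (g * u (y - k))" for y
  have \<Phi>: "\<Phi> \<subseteq> \<Gamma>" "x \<in> \<Phi>" "v \<in> \<Phi>" and I: "I \<subseteq> \<Phi>"
    using x v by (auto simp: \<Phi>_def I_def)
  have b0: "b y = 0" if "y \<in> \<Gamma> - \<Phi>" for y
    using that by (simp add: b_def \<Phi>_def supp_def)
  have card: "card \<Phi> \<le> n"
    unfolding n_def by (rule card_inj_on_le[of "\<lambda>y. y - k"]) (auto simp: \<Phi>_def inj_on_def finite_supp)
  have sym: "symbol g u (w(k := r)) z = (\<lambda>y. a y + of_real r * b y)" for r
    by (rule ext) (simp add: a_def b_def symbol_def alloy_potential_update[OF finite_supp, of w k r] algebra_simps)
  obtain p q where deg: "degree p \<le> card \<Phi>" "degree q \<le> card \<Phi>"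
    and real: "\<And>r e. e \<noteq> 0 \<Longrightarrow> \<forall>y\<in>\<Gamma>. Im (a y + r * b y) = e \<Longrightarrow>
      poly q r \<noteq> 0 \<and> lat.gf \<Gamma> (\<lambda>y. a y + r * b y) x v = poly p r / poly q r"
    and sol: "\<And>r. \<exists>\<psi>. \<psi> x = poly p r \<and>
      (\<forall>y\<in>\<Gamma>. (a y + r * b y) * \<psi> y - lat.hop \<Gamma> \<psi> y = of_bool (y = v) * poly q r)"
    using lat.gf_rational[where \<Gamma> = \<Gamma> and \<Phi> = \<Phi> and x = x and v = v and a = a and b = b,
        OF \<Gamma> \<Phi> b0] by blast
  have gf: "poly q (of_real r) \<noteq> 0 \<and> lat.gf \<Gamma> (symbol g u (w(k := r)) z) x v = poly p (of_real r) / poly q (of_real r)" for r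
    unfolding sym using z(1) by (intro real[of "- Im z"]) (auto simp: a_def b_def)
  \<comment> \<open>The interpolation points lie where the coupling and \<open>- z\<close> have imaginary parts of equal sign.\<close>
  define s where "s = - sgn (Im z)"
  have s: "\<bar>s\<bar> = 1" "s * s = 1" "s * Im z = - \<bar>Im z\<bar>"
    using z(1) by (auto simp: s_def sgn_if)
  \<comment> \<open>Unit spacing provides the separation required for interpolation.\<close>
  define \<xi> where "\<xi> j = \<i> * of_real (s * (T + real j))" for j :: nat
  have \<xi>: "cmod (\<xi> j) = T + real j" for j
    unfolding \<xi>_def norm_mult norm_of_real using s T_nonneg by (simp add: abs_mult)
  have sep: "1 \<le> cmod (\<xi> i - \<xi> j)" if "i \<noteq> j" for i j
  proof -
    have "\<xi> i - \<xi> j = \<i> * of_real (s * (real i - real j))"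
      by (simp add: \<xi>_def algebra_simps)
    then have "cmod (\<xi> i - \<xi> j) = \<bar>real i - real j\<bar>"
      by (simp only: norm_mult norm_of_real norm_ii abs_mult s(1) mult_1)
    with that show ?thesis by linarith
  qed
  have W: "\<bar>alloy_potential u (w(k := 0)) y\<bar> \<le> W" for y
    unfolding W_def using w R\<^sub>0_nonneg by (intro abs_alloy_potential_le finite_supp) auto
  have B: "cmod (poly p (\<xi> j)) \<le> 1 / g * cmod (poly q (\<xi> j))" for j
  proof -
    obtain \<psi> where \<psi>: "\<psi> x = poly p (\<xi> j)"
      "\<And>y. y \<in> \<Gamma> \<Longrightarrow> (a y + \<xi> j * b y) * \<psi> y - lat.hop \<Gamma> \<psi> y = of_bool (y = v) * poly q (\<xi> j)"
      using sol[of "\<xi> j"] by auto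
    \<comment> \<open>Multiplication by \<open>s\<close> makes the contribution of
      \<open>- z\<close> equal to \<open>\<bar>Im z\<bar>\<close>, so it can only help outside the
      block and on its boundary.\<close>
    have Im: "s * Im (a y + \<xi> j * b y) = g * (T + real j) * u (y - k) + \<bar>Im z\<bar>" for y
    proof -
      have eq: "Im (a y + \<xi> j * b y) = - Im z + s * ((T + real j) * (g * u (y - k)))"
        by (simp add: a_def b_def \<xi>_def)
      have "s * Im (a y + \<xi> j * b y) = - (s * Im z) + (s * s) * ((T + real j) * (g * u (y - k)))"
        unfolding eq by (simp add: algebra_simps)
      then show ?thesis using s by simp
    qed
    have u: "T * u\<^sub>0 \<le> (T + real j) * \<bar>u (y - k)\<bar>" if "y \<in> \<Phi>" for y
      using u\<^sub>0_le[of "y - k"] u\<^sub>0_pos T_nonneg that by (intro mult_mono) (auto simp: \<Phi>_def)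
    have Dg: "real D * real n \<le> g * (real D * real n)" "real D \<le> g * real D"
      using g mult_right_mono[of 1 g "real D * real n"] mult_right_mono[of 1 g "real D"] by simp_all
    have "g * cmod (\<psi> x) \<le> cmod (poly q (\<xi> j))"
    proof (rule lat.block_bound[where \<Gamma> = \<Gamma> and \<Phi> = \<Phi> and I = I and v = v and s = s
        and a = "\<lambda>y. a y + \<xi> j * b y" and \<psi> = \<psi>])
      fix y y' assume y: "y \<in> I" "y' \<in> \<Gamma>" "nb y y'"
      then have "nb (y - k) (y' - k)" by (simp add: nb_def)
      then have "y' - k \<in> supp u"
        using y by (intro nbrs_of_interior[of "supp u" "y - k" "y' - k"] finite_supp) (auto simp: I_def \<Phi>_def)
      then show "y' \<in> \<Phi>" using y by (simp add: \<Phi>_def)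
    next
      fix y assume "y \<in> \<Gamma> - \<Phi>"
      then have "u (y - k) = 0" by (auto simp: \<Phi>_def supp_def)
      then show "0 \<le> s * Im (a y + \<xi> j * b y)" unfolding Im by simp
    next
      fix y assume y: "y \<in> \<Phi> - I"
      then have "0 < u (y - k)"
        using boundary_pos by (auto simp: I_def)
      then have "g * (T * u\<^sub>0) \<le> g * ((T + real j) * u (y - k))"
        using u[of y] y g by (intro mult_left_mono) auto
      \<comment> \<open>At boundary sites the summands \<open>D * n + 1\<close> of
        \<open>T * u\<^sub>0\<close> supply the margin; multiplying by \<open>g \<ge> 1\<close>
        yields the required extra \<open>g\<close>.\<close>
      moreover have "g * (real D * real n + 1) \<le> g * (T * u\<^sub>0)"
        unfolding T_u\<^sub>0 using g W_nonneg by (intro mult_left_mono) (auto simp: E\<^sub>0_def)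
      moreover have "real D * real (card \<Phi>) \<le> real D * real n"
        using card by (intro mult_left_mono) auto
      ultimately show "real (2 * CARD('d)) * real (card \<Phi>) + g \<le> s * Im (a y + \<xi> j * b y)"
        unfolding Im D_def[symmetric] using Dg by (simp add: algebra_simps)
    next
      fix y assume y: "y \<in> I"
      have "cmod (\<xi> j * b y) = g * ((T + real j) * \<bar>u (y - k)\<bar>)"
        using g by (simp add: norm_mult \<xi> b_def abs_mult)
      moreover have "g * (T * u\<^sub>0) \<le> g * ((T + real j) * \<bar>u (y - k)\<bar>)"
        using u[of y] y I g by (intro mult_left_mono) auto
      moreover have "cmod (a y) \<le> g * W + E\<^sub>0 * g"
      proof -
        have "cmod (a y) \<le> g * \<bar>alloy_potential u (w(k := 0)) y\<bar> + cmod z"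
          unfolding a_def symbol_def using g
            norm_triangle_ineq4[of "of_real (g * alloy_potential u (w(k := 0)) y)" z]
          by (simp add: norm_mult abs_mult)
        also have "\<dots> \<le> g * W + E\<^sub>0 * g"
          using W[of y] g z by (intro add_mono mult_left_mono) auto
        finally show ?thesis .
      qed
      moreover have "cmod (\<xi> j * b y) - cmod (a y) \<le> cmod (a y + \<xi> j * b y)"
        using norm_triangle_ineq2[of "\<xi> j * b y" "- a y"] by (simp add: add.commute)
      \<comment> \<open>At interior sites \<open>W + E\<^sub>0\<close> outweighs the value of the
        diagonal at coupling zero, and \<open>D + 1\<close> leaves the margin
        \<open>D + g\<close>.\<close>
      moreover have "g * (T * u\<^sub>0) = g * (real D * real n) + g + g * real D + g * W + E\<^sub>0 * g"
        unfolding T_u\<^sub>0 by (simp add: algebra_simps)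
      ultimately show "real (2 * CARD('d)) + g \<le> cmod (a y + \<xi> j * b y)"
        unfolding D_def[symmetric] using Dg mult_nonneg_nonneg[of "real D" "real n"] by linarith
    qed (use \<Gamma> \<Phi> I s g \<psi> in auto)
    then show ?thesis
      using g \<psi>(1) by (simp add: field_simps)
  qed
  have q0: "q \<noteq> 0"
    using gf[of 0] by auto
  have "\<exists>c m. m \<le> n \<and> (\<forall>r L. (\<forall>i\<le>n. cmod (r - \<xi> i) \<le> L) \<longrightarrow> poly q r \<noteq> 0 \<longrightarrow>
      cmod (poly p r / poly q r) \<le> 1 / g * (real (n + 1) * L ^ n) * (\<Prod>i<m. 1 + L / cmod (r - c i)))"
    using q0 deg card sep B g by (intro rational_bound) auto
  then obtain c m where m: "m \<le> n" and c: "\<And>r L. \<forall>i\<le>n. cmod (r - \<xi> i) \<le> L \<Longrightarrow> poly q r \<noteq> 0 \<Longrightarrow>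
      cmod (poly p r / poly q r) \<le> 1 / g * (real (n + 1) * L ^ n) * (\<Prod>i<m. 1 + L / cmod (r - c i))"
    by blast
  show ?thesis
  proof (intro exI[of _ m] exI[of _ c] conjI m allI impI)
    fix r :: real assume r: "\<bar>r\<bar> \<le> R\<^sub>0"
    have "\<forall>i\<le>n. cmod (of_real r - \<xi> i) \<le> L"
    proof (intro allI impI)
      fix i assume "i \<le> n"
      then show "cmod (of_real r - \<xi> i) \<le> L"
        using norm_triangle_ineq4[of "of_real r" "\<xi> i"] r by (simp add: \<xi> L_def)
    qed
    from c[of "of_real r" L, OF this] show "cmod (lat.gf \<Gamma> (symbol g u (w(k := r)) z) x v) \<le>
      K / g * (\<Prod>i<m. 1 + L / cmod (of_real r - c i))"
      using gf[of r] by (simp add: K_def)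
  qed
qed

text \<open>The leading \<open>1\<close> covers large energies. The rest is the interpolation factor
  times one plus \<open>n\<close> singularity moments of order \<open>n * \<tau>\<close>.\<close>

definition moment_const :: "real \<Rightarrow> real" where
  "moment_const \<tau> = 1 + K powr \<tau> *
    (1 + real n * (1 + L powr (real n * \<tau>) * (1 + C\<^sub>0 * (2 / (1 - real n * \<tau>)))))"

lemma moment_const_ge_1:
  assumes "real n * \<tau> < 1"
  shows "1 \<le> moment_const \<tau>"
  unfolding moment_const_def using assms C\<^sub>0 by simp

text \<open>At low energies the rational bound is split into single singularities and integrated; at
  high energies the deterministic bound \<open>1 / g\<close> suffices. The coupling at
  \<open>k\<close> is the integration variable, so only the other couplings are assumed
  bounded.\<close>

lemma conditional_moment_bound:
  assumes \<Gamma>: "finite \<Gamma>" and x: "x \<in> \<Gamma>" "x - k \<in> supp u" and v: "v \<in> \<Gamma>" "v - k \<in> supp u"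
    and g: "1 \<le> g" and z: "Im z \<noteq> 0" and \<tau>: "0 < \<tau>" "real n * \<tau> < 1"
    and w: "\<And>j. j \<noteq> k \<Longrightarrow> \<bar>w j\<bar> \<le> R\<^sub>0"
  shows "(\<integral>\<^sup>+ r. ennreal (cmod (lat.gf \<Gamma> (symbol g u (w(k := r)) z) x v) powr \<tau>) \<partial>\<nu>) \<le>
    ennreal (moment_const \<tau> * g powr - \<tau>)"
proof (cases "cmod z \<le> E\<^sub>0 * g")
  case True
  obtain m b where m: "m \<le> n" and b: "\<And>r. \<bar>r\<bar> \<le> R\<^sub>0 \<Longrightarrow>
      cmod (lat.gf \<Gamma> (symbol g u (w(k := r)) z) x v) \<le>
        K / g * (\<Prod>i<m. 1 + L / cmod (of_real r - b i))"
    using gf_single_site[where w = w, OF \<Gamma> x v g z True w] by blast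
  let ?\<kappa> = "real n * \<tau>"
  let ?t = "\<lambda>i r. 1 + L / cmod (of_real r - b i)"
  let ?M = "1 + L powr ?\<kappa> * (1 + C\<^sub>0 * (2 / (1 - ?\<kappa>)))"
  let ?c = "(K / g) powr \<tau>"
  have \<kappa>: "0 < ?\<kappa>" using n_pos \<tau> by simp
  have M: "0 \<le> ?M" using C\<^sub>0 \<tau> by simp
  have t: "1 \<le> ?t i r" for i r using L_nonneg by simp
  have "(\<integral>\<^sup>+ r. ennreal (cmod (lat.gf \<Gamma> (symbol g u (w(k := r)) z) x v) powr \<tau>) \<partial>\<nu>) \<le>
      (\<integral>\<^sup>+ r. ennreal ?c * (1 + (\<Sum>i<m. ennreal (?t i r powr ?\<kappa>))) \<partial>\<nu>)"
  proof (rule nn_integral_mono_AE)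
    show "AE r in \<nu>. ennreal (cmod (lat.gf \<Gamma> (symbol g u (w(k := r)) z) x v) powr \<tau>) \<le>
        ennreal ?c * (1 + (\<Sum>i<m. ennreal (?t i r powr ?\<kappa>)))"
      using bounded
    proof eventually_elim
      case (elim r)
      have "cmod (lat.gf \<Gamma> (symbol g u (w(k := r)) z) x v) powr \<tau> \<le> (K / g * (\<Prod>i<m. ?t i r)) powr \<tau>"
        using b[OF elim] \<tau> by (intro powr_mono2) auto
      also have "\<dots> = ?c * (\<Prod>i<m. ?t i r) powr \<tau>"
        using K_nonneg g t by (subst powr_mult) (auto intro!: prod_nonneg intro: order_trans[of 0 1])
      also have "\<dots> \<le> ?c * (1 + (\<Sum>i<m. ?t i r powr ?\<kappa>))"
        using t m \<tau> by (intro mult_left_mono prod_powr_le_sum_powr) auto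
      finally have "ennreal (cmod (lat.gf \<Gamma> (symbol g u (w(k := r)) z) x v) powr \<tau>) \<le>
          ennreal (?c * (1 + (\<Sum>i<m. ?t i r powr ?\<kappa>)))"
        by (rule ennreal_leI)
      also have "\<dots> = ennreal ?c * (1 + (\<Sum>i<m. ennreal (?t i r powr ?\<kappa>)))"
        by (subst ennreal_mult') (auto simp: ennreal_plus sum_nonneg)
      finally show ?case .
    qed
  qed
  also have "\<dots> = ennreal ?c * (1 + (\<Sum>i<m. \<integral>\<^sup>+ r. ennreal (?t i r powr ?\<kappa>) \<partial>\<nu>))"
    by (simp add: nn_integral_cmult nn_integral_add nn_integral_sum emeasure_space_1 del: sum_ennreal)
  also have "\<dots> \<le> ennreal ?c * (1 + (\<Sum>i<m. ennreal ?M))"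
    using \<kappa> \<tau> L_nonneg by (intro mult_left_mono add_left_mono sum_mono singularity_moment) auto
  also have "(\<Sum>i<m. ennreal ?M) = ennreal (real m * ?M)"
    using M by (simp only: sum_ennreal) simp
  also have "ennreal ?c * (1 + ennreal (real m * ?M)) = ennreal ?c * ennreal (1 + real m * ?M)"
    using M by (subst ennreal_plus) auto
  also have "\<dots> = ennreal (?c * (1 + real m * ?M))"
    by (rule ennreal_mult'[symmetric]) simp
  also have "\<dots> \<le> ennreal (moment_const \<tau> * g powr - \<tau>)"
  proof (rule ennreal_leI)
    have "?c = K powr \<tau> * g powr - \<tau>"
      using K_nonneg g by (simp add: powr_divide powr_minus_divide)
    then have "?c * (1 + real m * ?M) \<le> K powr \<tau> * g powr - \<tau> * (1 + real n * ?M)"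
      using m M by (intro mult_mono add_left_mono mult_right_mono) auto
    also have "\<dots> \<le> moment_const \<tau> * g powr - \<tau>"
      unfolding moment_const_def using g by (simp add: algebra_simps)
    finally show "?c * (1 + real m * ?M) \<le> moment_const \<tau> * g powr - \<tau>" .
  qed
  finally show ?thesis .
next
  case False
  have "(\<integral>\<^sup>+ r. ennreal (cmod (lat.gf \<Gamma> (symbol g u (w(k := r)) z) x v) powr \<tau>) \<partial>\<nu>) \<le>
      (\<integral>\<^sup>+ r. ennreal (g powr - \<tau>) \<partial>\<nu>)"
  proof (rule nn_integral_mono_AE)
    show "AE r in \<nu>. ennreal (cmod (lat.gf \<Gamma> (symbol g u (w(k := r)) z) x v) powr \<tau>) \<le> ennreal (g powr - \<tau>)"
      using bounded
    proof eventually_elim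
      case (elim r)
      have "cmod (lat.gf \<Gamma> (symbol g u (w(k := r)) z) x v) \<le> 1 / g"
        using elim w z False by (intro gf_large_energy \<Gamma> x v g) auto
      then have "cmod (lat.gf \<Gamma> (symbol g u (w(k := r)) z) x v) powr \<tau> \<le> (1 / g) powr \<tau>"
        using \<tau> by (intro powr_mono2) auto
      also have "\<dots> = g powr - \<tau>"
        using g by (simp add: powr_divide powr_minus_divide)
      finally show ?case by (rule ennreal_leI)
    qed
  qed
  also have "\<dots> = ennreal (g powr - \<tau>)"
    by (simp add: emeasure_space_1)
  also have "\<dots> \<le> ennreal (moment_const \<tau> * g powr - \<tau>)"
    using mult_right_mono[OF moment_const_ge_1[OF \<tau>(2)], of "g powr - \<tau>"] by (intro ennreal_leI) simp
  finally show ?thesis .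
qed

end

section \<open>Infinite volumes\<close>

definition truncation :: "(int ^ 'd) set \<Rightarrow> nat \<Rightarrow> (int ^ 'd) set" where
  "truncation \<Gamma> N = {x \<in> \<Gamma>. norm_max x \<le> int N}"

lemma finite_truncation: "finite (truncation \<Gamma> N)"
proof (rule finite_imageD[where f = vec_nth])
  have "vec_nth ` truncation \<Gamma> N \<subseteq> UNIV \<rightarrow>\<^sub>E {- int N..int N}"
    by (auto simp: truncation_def norm_max_le_iff abs_le_iff) (metis minus_le_iff)
  then show "finite (vec_nth ` truncation \<Gamma> N)"
    by (rule finite_subset) (intro finite_PiE, auto)
  show "inj_on vec_nth (truncation \<Gamma> N)"
    by (simp add: inj_on_def vec_nth_inject)
qed

lemma truncation_subset: "truncation \<Gamma> N \<subseteq> \<Gamma>"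
  by (auto simp: truncation_def)

lemma eventually_truncation: "x \<in> \<Gamma> \<Longrightarrow> \<forall>\<^sub>F N in sequentially. x \<in> truncation \<Gamma> N"
  unfolding eventually_sequentially truncation_def
  by (intro exI[of _ "nat (norm_max x)"]) auto

text \<open>The source has norm one, so the energy estimate bounds the solution uniformly in
  \<open>N\<close>. Arbitrary finite \<open>F\<close> is the form in which the bound survives
  pointwise limits.\<close>

lemma truncated_energy:
  assumes e: "\<forall>x\<in>\<Gamma>. Im (a x) = e" "e \<noteq> 0" and F: "finite F"
  shows "(\<Sum>x\<in>F. (cmod (lat.gf (truncation \<Gamma> N) a x y))\<^sup>2) \<le> 1 / e\<^sup>2"
proof (cases "y \<in> truncation \<Gamma> N")
  case True
  let ?T = "truncation \<Gamma> N" and ?\<psi> = "\<lambda>x. lat.gf (truncation \<Gamma> N) a x y"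
  have eT: "\<forall>x\<in>?T. Im (a x) = e"
    using e truncation_subset by blast
  have "e\<^sup>2 * (\<Sum>x\<in>?T. (cmod (?\<psi> x))\<^sup>2) \<le> (\<Sum>x\<in>?T. (cmod (of_bool (x = y)))\<^sup>2)"
    using lat.gf_eq[OF finite_truncation eT e(2) _ True]
    by (intro lat.energy_estimate[of ?T a ?\<psi>, OF _ eT]) auto
  also have "\<dots> = (\<Sum>x\<in>?T. if x = y then 1 else 0)"
    by (intro sum.cong) auto
  also have "\<dots> = 1"
    using True by (simp add: finite_truncation)
  finally have "(\<Sum>x\<in>?T. (cmod (?\<psi> x))\<^sup>2) \<le> 1 / e\<^sup>2"
    using e(2) by (simp add: field_simps)
  moreover have "(\<Sum>x\<in>F. (cmod (?\<psi> x))\<^sup>2) = (\<Sum>x\<in>F \<inter> ?T. (cmod (?\<psi> x))\<^sup>2)"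
    using F by (intro sum.mono_neutral_right) (auto simp: lat.gf_def)
  moreover have "\<dots> \<le> (\<Sum>x\<in>?T. (cmod (?\<psi> x))\<^sup>2)"
    using finite_truncation by (intro sum_mono2) auto
  ultimately show ?thesis by linarith
next
  case False
  then have "lat.gf (truncation \<Gamma> N) a x y = 0" for x
    by (simp add: lat.gf_def)
  then show ?thesis by simp
qed

text \<open>A compactness argument: finite-volume solutions are uniformly bounded, a subsequence
  converges at every site, and the uniform bound on finite sums puts the limit in
  \<open>ell2 \<Gamma>\<close>.\<close>

lemma exists_ell2_solution:
  fixes \<Gamma> :: "(int ^ 'd) set"
  assumes e: "\<forall>x\<in>\<Gamma>. Im (a x) = e" "e \<noteq> 0" and y: "y \<in> \<Gamma>"
  shows "\<exists>\<psi>\<in>ell2 \<Gamma>. \<forall>x\<in>\<Gamma>. a x * \<psi> x - laplacian \<psi> x = of_bool (x = y)"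
proof -
  define f where "f N x = lat.gf (truncation \<Gamma> N) a x y" for N x
  have bound: "cmod (f N x) \<le> 1 / \<bar>e\<bar>" for N x
  proof -
    have "(cmod (f N x))\<^sup>2 \<le> (1 / \<bar>e\<bar>)\<^sup>2"
      using truncated_energy[OF e, of "{x}" N y] by (simp add: f_def power_divide)
    then show ?thesis
      by (rule power2_le_imp_le) simp
  qed
  \<comment> \<open>The lattice is countable, so a diagonal sequence converges at all sites at
    once.\<close>
  obtain k where k: "strict_mono k" "\<And>x. x \<in> UNIV \<Longrightarrow> \<exists>l. (\<lambda>N. f (k N) x) \<longlonglongrightarrow> l"
    by (rule function_convergent_subsequence[of UNIV f "1 / \<bar>e\<bar>", OF countableI_type bound]) blast
  define \<psi> where "\<psi> x = lim (\<lambda>N. f (k N) x)" for x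
  have \<psi>: "(\<lambda>N. f (k N) x) \<longlonglongrightarrow> \<psi> x" for x
    using k(2)[of x] unfolding \<psi>_def convergent_LIMSEQ_iff[symmetric] by (simp add: convergent_def)
  have off: "\<psi> x = 0" if "x \<notin> \<Gamma>" for x
  proof -
    have "f N x = 0" for N
      using that truncation_subset[of \<Gamma> N] by (auto simp: f_def lat.gf_def)
    then have "(\<lambda>N. f (k N) x) \<longlonglongrightarrow> 0" by simp
    with \<psi>[of x] show ?thesis by (rule LIMSEQ_unique)
  qed
  have "(\<lambda>x. (cmod (\<psi> x))\<^sup>2) summable_on UNIV"
  proof (rule nonneg_bdd_above_summable_on)
    show "bdd_above (sum (\<lambda>x. (cmod (\<psi> x))\<^sup>2) ` {F. F \<subseteq> UNIV \<and> finite F})"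
    proof (intro bdd_aboveI2[where M = "1 / e\<^sup>2"])
      fix F :: "(int ^ 'd) set" assume "F \<in> {F. F \<subseteq> UNIV \<and> finite F}"
      then have F: "finite F" by simp
      have "(\<lambda>N. \<Sum>x\<in>F. (cmod (f (k N) x))\<^sup>2) \<longlonglongrightarrow> (\<Sum>x\<in>F. (cmod (\<psi> x))\<^sup>2)"
        by (intro tendsto_intros \<psi>)
      then show "(\<Sum>x\<in>F. (cmod (\<psi> x))\<^sup>2) \<le> 1 / e\<^sup>2"
        by (rule LIMSEQ_le_const2) (use truncated_energy[OF e F] in \<open>auto simp: f_def\<close>)
    qed
  qed auto
  then have "\<psi> \<in> ell2 \<Gamma>"
    using off by (simp add: ell2_def)
  moreover have "a x * \<psi> x - laplacian \<psi> x = of_bool (x = y)" if x: "x \<in> \<Gamma>" for x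
  proof -
    have "(\<lambda>N. a x * f (k N) x - laplacian (f (k N)) x) \<longlonglongrightarrow> a x * \<psi> x - laplacian \<psi> x"
      unfolding laplacian_def by (intro tendsto_intros \<psi>)
    \<comment> \<open>The equation at \<open>x\<close> involves finitely many sites and holds
      exactly as soon as the truncation contains \<open>x\<close> and \<open>y\<close>.\<close>
    moreover have "\<forall>\<^sub>F N in sequentially. a x * f (k N) x - laplacian (f (k N)) x = of_bool (x = y)"
    proof -
      have "\<forall>\<^sub>F N in sequentially. x \<in> truncation \<Gamma> (k N) \<and> y \<in> truncation \<Gamma> (k N)"
        using eventually_conj[OF eventually_truncation[OF x] eventually_truncation[OF y]]
          filterlim_subseq[OF k(1)] unfolding filterlim_iff by blast
      then show ?thesis
      proof eventually_elim
        case (elim N)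
        let ?T = "truncation \<Gamma> (k N)"
        have "laplacian (f (k N)) x = lat.hop ?T (f (k N)) x"
          by (rule laplacian_eq_hop[OF finite_truncation]) (simp add: f_def lat.gf_def)
        moreover have "\<forall>x\<in>?T. Im (a x) = e"
          using e truncation_subset by blast
        ultimately show ?case
          using lat.gf_eq[OF finite_truncation _ e(2), of \<Gamma> "k N" a x y] elim
          by (simp add: f_def[abs_def])
      qed
    qed
    then have "(\<lambda>N. a x * f (k N) x - laplacian (f (k N)) x) \<longlonglongrightarrow> of_bool (x = y)"
      by (rule tendsto_eventually)
    ultimately show ?thesis
      by (rule LIMSEQ_unique)
  qed
  ultimately show ?thesis by blast
qed

text \<open>A finite set carrying almost all of the squared norm is, up to sites where
  \<open>\<psi>\<close> vanishes, eventually inside the truncation. Anything disjoint from the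
  truncation then has small mass.\<close>

lemma ell2_tail:
  fixes \<psi> :: "int ^ 'd \<Rightarrow> complex"
  assumes \<psi>: "\<psi> \<in> ell2 \<Gamma>" and \<epsilon>: "0 < \<epsilon>"
  shows "\<forall>\<^sub>F N in sequentially. \<forall>Y. finite Y \<longrightarrow> Y \<inter> truncation \<Gamma> N = {} \<longrightarrow> (\<Sum>x\<in>Y. (cmod (\<psi> x))\<^sup>2) < \<epsilon>"
proof -
  let ?f = "\<lambda>x. (cmod (\<psi> x))\<^sup>2" and ?S = "\<Sum>\<^sub>\<infinity>x. (cmod (\<psi> x))\<^sup>2"
  have sm: "?f summable_on UNIV" and off: "\<And>x. x \<notin> \<Gamma> \<Longrightarrow> \<psi> x = 0"
    using \<psi> by (auto simp: ell2_def)
  have "(sum ?f \<longlongrightarrow> ?S) (finite_subsets_at_top UNIV)"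
    using has_sum_infsum[OF sm] by (simp add: has_sum_def)
  then have "\<forall>\<^sub>F F in finite_subsets_at_top UNIV. ?S - \<epsilon> < sum ?f F"
    using \<epsilon> by (intro order_tendstoD(1)) auto
  then obtain F where F: "finite F" "\<And>F'. finite F' \<Longrightarrow> F \<subseteq> F' \<Longrightarrow> ?S - \<epsilon> < sum ?f F'"
    unfolding eventually_finite_subsets_at_top by auto
  have "\<forall>\<^sub>F N in sequentially. \<forall>x\<in>F \<inter> \<Gamma>. x \<in> truncation \<Gamma> N"
    using F(1) by (intro eventually_ball_finite ballI eventually_truncation) auto
  then show ?thesis
  proof eventually_elim
    case (elim N)
    show ?case
    proof (intro allI impI)
      fix Y assume Y: "finite Y" "Y \<inter> truncation \<Gamma> N = {}"
      have "sum ?f F + sum ?f (Y - F) = sum ?f (F \<union> Y)"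
        using F(1) Y(1) sum.union_disjoint[of F "Y - F" ?f] by (simp add: Un_Diff_cancel)
      also have "\<dots> \<le> ?S"
        using F(1) Y(1) by (intro finite_sum_le_infsum sm) auto
      finally have "sum ?f (Y - F) < \<epsilon>"
        using F(2)[of F] F(1) by simp
      moreover have "sum ?f Y = sum ?f (Y - F)"
        using Y elim off by (intro sum.mono_neutral_right) auto
      ultimately show "sum ?f Y < \<epsilon>" by simp
    qed
  qed
qed

text \<open>
  Any solution in \<open>ell2 \<Gamma>\<close> is the limit of the finite-volume ones, so the choice made by
  \<open>inv_into\<close> in the definition of \<open>resolvent\<close> does not matter, and no uniqueness statement is needed.
\<close>

lemma gf_truncation_tendsto:
  fixes \<Gamma> :: "(int ^ 'd) set"
  assumes e: "\<forall>x\<in>\<Gamma>. Im (a x) = e" "e \<noteq> 0" and x: "x \<in> \<Gamma>" and y: "y \<in> \<Gamma>"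
    and \<psi>: "\<psi> \<in> ell2 \<Gamma>" and eq: "\<And>x. x \<in> \<Gamma> \<Longrightarrow> a x * \<psi> x - laplacian \<psi> x = of_bool (x = y)"
  shows "(\<lambda>N. lat.gf (truncation \<Gamma> N) a x y) \<longlonglongrightarrow> \<psi> x"
proof (rule LIMSEQ_I)
  fix \<epsilon> :: real assume \<epsilon>: "0 < \<epsilon>"
  let ?D = "real (2 * CARD('d))"
  \<comment> \<open>Chosen so that
    \<open>?D\<^sup>2 * \<delta> = e\<^sup>2 * \<epsilon>\<^sup>2\<close> at the end of the
    estimate.\<close>
  define \<delta> where "\<delta> = (e * \<epsilon> / ?D)\<^sup>2"
  have D: "0 < ?D" by simp
  have \<delta>: "0 < \<delta>" using \<epsilon> e(2) D by (simp add: \<delta>_def)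
  have "\<forall>\<^sub>F N in sequentially. cmod (lat.gf (truncation \<Gamma> N) a x y - \<psi> x) < \<epsilon>"
    using eventually_truncation[OF x] eventually_truncation[OF y] ell2_tail[OF \<psi> \<delta>]
  proof eventually_elim
    case (elim N)
    let ?T = "truncation \<Gamma> N"
    \<comment> \<open>\<open>Y\<close> is the outer boundary of the truncation. The difference
      \<open>h\<close> solves the finite-volume equation with source \<open>hop Y \<psi>\<close>,
      which is small because \<open>\<psi>\<close> has a small tail.\<close>
    define Y where "Y = (\<Union>v\<in>?T. {w. nb v w}) - ?T"
    define h where "h v = \<psi> v - lat.gf ?T a v y" for v
    have eT: "\<forall>x\<in>?T. Im (a x) = e"
      using e truncation_subset by blast
    have finY: "finite Y"
      unfolding Y_def using finite_truncation lat.finite_nbrs by blast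
    have lap: "laplacian \<psi> v = lat.hop ?T \<psi> v + lat.hop Y \<psi> v" if v: "v \<in> ?T" for v
    proof -
      have "laplacian \<psi> v = lat.hop (?T \<union> Y) \<psi> v"
        unfolding laplacian_nbrs using finite_truncation finY v
        by (subst lat.hop_nbrs) (auto intro!: sum.cong simp: Y_def)
      also have "\<dots> = lat.hop ?T \<psi> v + lat.hop Y \<psi> v"
        using finite_truncation finY by (intro lat.hop_Un) (auto simp: Y_def)
      finally show ?thesis .
    qed
    have "a v * h v - lat.hop ?T h v = lat.hop Y \<psi> v" if v: "v \<in> ?T" for v
    proof -
      have "a v * \<psi> v = of_bool (v = y) + (lat.hop ?T \<psi> v + lat.hop Y \<psi> v)"
        using eq[of v] lap[OF v] v truncation_subset by (force simp: diff_eq_eq)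
      moreover have "a v * lat.gf ?T a v y = of_bool (v = y) + lat.hop ?T (\<lambda>v. lat.gf ?T a v y) v"
        using lat.gf_eq[OF finite_truncation eT e(2) v, of y] elim by (simp add: diff_eq_eq)
      ultimately show ?thesis
        unfolding h_def by (simp add: lat.hop_diff right_diff_distrib)
    qed
    then have "e\<^sup>2 * (\<Sum>v\<in>?T. (cmod (h v))\<^sup>2) \<le> (\<Sum>v\<in>?T. (cmod (lat.hop Y \<psi> v))\<^sup>2)"
      using eT by (rule lat.energy_estimate)
    \<comment> \<open>Cauchy-Schwarz over at most \<open>?D\<close> neighbours gives one factor
      \<open>?D\<close>; after the sums are exchanged, each site of \<open>Y\<close> is counted at
      most \<open>?D\<close> times, which gives the second.\<close>
    also have "\<dots> \<le> (\<Sum>v\<in>?T. ?D * (\<Sum>w\<in>Y. of_bool (nb v w) * (cmod (\<psi> w))\<^sup>2))"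
    proof (rule sum_mono)
      fix v
      let ?A = "Y \<inter> {w. nb v w}"
      have "(cmod (lat.hop Y \<psi> v))\<^sup>2 \<le> (\<Sum>w\<in>?A. cmod (\<psi> w))\<^sup>2"
        unfolding lat.hop_nbrs[OF finY] by (intro power_mono norm_sum) auto
      also have "\<dots> \<le> (\<Sum>w\<in>?A. (cmod (\<psi> w))\<^sup>2) * real (card ?A)"
        by (rule sum_squared_le_sum_of_squares)
      also have "\<dots> \<le> (\<Sum>w\<in>?A. (cmod (\<psi> w))\<^sup>2) * ?D"
      proof (intro mult_left_mono sum_nonneg)
        have "card ?A \<le> 2 * CARD('d)"
          using card_mono[OF lat.finite_nbrs[of v], of ?A] lat.card_nbrs[of v] by auto
        then show "real (card ?A) \<le> ?D" by (simp only: of_nat_le_iff)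
      qed auto
      also have "(\<Sum>w\<in>?A. (cmod (\<psi> w))\<^sup>2) = (\<Sum>w\<in>Y. of_bool (nb v w) * (cmod (\<psi> w))\<^sup>2)"
        using finY by (subst sum.inter_restrict) (auto intro!: sum.cong simp: of_bool_def)
      finally show "(cmod (lat.hop Y \<psi> v))\<^sup>2 \<le> ?D * (\<Sum>w\<in>Y. of_bool (nb v w) * (cmod (\<psi> w))\<^sup>2)"
        by (simp only: mult.commute)
    qed
    also have "\<dots> = ?D * (\<Sum>w\<in>Y. \<Sum>v\<in>?T. of_bool (nb v w) * (cmod (\<psi> w))\<^sup>2)"
      by (simp only: sum_distrib_left[symmetric] sum.swap[of _ Y])
    also have "\<dots> \<le> ?D * (\<Sum>w\<in>Y. ?D * (cmod (\<psi> w))\<^sup>2)"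
    proof (intro mult_left_mono sum_mono)
      fix w
      have "(\<Sum>v\<in>?T. of_bool (nb v w) :: real) = real (card (?T \<inter> {v. nb w v}))"
        using lat.adj_sym[of _ w] by (simp add: finite_truncation)
      also have "\<dots> \<le> ?D"
        using card_mono[OF lat.finite_nbrs[of w], of "?T \<inter> {v. nb w v}"] lat.card_nbrs[of w]
        by (simp only: of_nat_le_iff) auto
      finally show "(\<Sum>v\<in>?T. of_bool (nb v w) * (cmod (\<psi> w))\<^sup>2) \<le> ?D * (cmod (\<psi> w))\<^sup>2"
        unfolding sum_distrib_right[symmetric] by (rule mult_right_mono) simp
    qed simp
    also have "\<dots> = ?D\<^sup>2 * (\<Sum>w\<in>Y. (cmod (\<psi> w))\<^sup>2)"
      by (simp add: sum_distrib_left power2_eq_square mult.assoc)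
    also have "\<dots> < ?D\<^sup>2 * \<delta>"
      using elim(3) finY D by (intro mult_strict_left_mono) (auto simp: Y_def)
    also have "\<dots> = e\<^sup>2 * \<epsilon>\<^sup>2"
      using D by (simp add: \<delta>_def power_mult_distrib power_divide)
    finally have "(\<Sum>v\<in>?T. (cmod (h v))\<^sup>2) < \<epsilon>\<^sup>2"
      using e(2) by (simp add: mult_less_cancel_left_pos)
    moreover have "(cmod (h x))\<^sup>2 \<le> (\<Sum>v\<in>?T. (cmod (h v))\<^sup>2)"
      using elim(1) finite_truncation by (intro member_le_sum[of x ?T "\<lambda>v. (cmod (h v))\<^sup>2"]) auto
    ultimately have "(cmod (h x))\<^sup>2 < \<epsilon>\<^sup>2" by linarith
    then have "cmod (h x) < \<epsilon>"
      by (rule power2_less_imp_less) (use \<epsilon> in simp)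
    then show ?case
      by (simp add: h_def norm_minus_commute)
  qed
  then show "\<exists>N\<^sub>0. \<forall>N\<ge>N\<^sub>0. norm (lat.gf (truncation \<Gamma> N) a x y - \<psi> x) < \<epsilon>"
    by (simp add: eventually_sequentially)
qed

text \<open>Existence of an \<open>ell2\<close> solution places \<open>delta y\<close> in the range
  of the operator, so \<open>inv_into\<close> returns a genuine solution, to which the convergence
  result applies.\<close>

lemma green_eq_limit:
  fixes \<Gamma> :: "(int ^ 'd) set"
  assumes z: "Im z \<noteq> 0" and x: "x \<in> \<Gamma>" and y: "y \<in> \<Gamma>"
  shows "(\<lambda>N. lat.gf (truncation \<Gamma> N) (symbol g u w z) x y) \<longlonglongrightarrow> green g u w \<Gamma> z x y"
proof -
  let ?a = "symbol g u w z"
  let ?f = "\<lambda>\<psi> x. compression \<Gamma> (hamiltonian g u w) \<psi> x - z * \<psi> x"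
  define \<psi> where "\<psi> = resolvent \<Gamma> (compression \<Gamma> (hamiltonian g u w)) z (delta y)"
  have f: "?f \<phi> v = ?a v * \<phi> v - laplacian \<phi> v" if "v \<in> \<Gamma>" for \<phi> v
    using that by (simp add: compression_def hamiltonian_def symbol_def algebra_simps)
  have e: "\<forall>x\<in>\<Gamma>. Im (?a x) = - Im z" "- Im z \<noteq> 0"
    using z by auto
  obtain \<phi> where \<phi>: "\<phi> \<in> ell2 \<Gamma>" "\<And>v. v \<in> \<Gamma> \<Longrightarrow> ?a v * \<phi> v - laplacian \<phi> v = of_bool (v = y)"
    using exists_ell2_solution[OF e y] by auto
  have sol: "?f \<phi> = delta y"
  proof
    fix v show "?f \<phi> v = delta y v"
    proof (cases "v \<in> \<Gamma>")
      case True
      then show ?thesis using f[OF True, of \<phi>] \<phi>(2) by (simp add: delta_def)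
    next
      case False
      then show ?thesis using \<phi>(1) y by (auto simp: compression_def delta_def ell2_def)
    qed
  qed
  have range: "delta y \<in> ?f ` ell2 \<Gamma>"
    by (rule image_eqI[where f = ?f and x = \<phi>, OF sol[symmetric] \<phi>(1)])
  have "\<psi> \<in> ell2 \<Gamma>"
    unfolding \<psi>_def resolvent_def by (rule inv_into_into[where f = ?f, OF range])
  have eq: "?f \<psi> = delta y"
    unfolding \<psi>_def resolvent_def by (rule f_inv_into_f[where f = ?f, OF range])
  have "(\<lambda>N. lat.gf (truncation \<Gamma> N) ?a x y) \<longlonglongrightarrow> \<psi> x"
  proof (rule gf_truncation_tendsto[OF e x y \<open>\<psi> \<in> ell2 \<Gamma>\<close>])
    fix v assume v: "v \<in> \<Gamma>"
    have "?f \<psi> v = delta y v"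
      using eq by (rule fun_cong)
    then show "?a v * \<psi> v - laplacian \<psi> v = of_bool (v = y)"
      unfolding f[OF v] by (simp add: delta_def)
  qed
  moreover have "green g u w \<Gamma> z x y = \<psi> x"
  proof -
    have "ell2_inner (delta x) \<psi> = (\<Sum>\<^sub>\<infinity>k\<in>{x}. cnj (delta x k) * \<psi> k)"
      unfolding ell2_inner_def by (rule infsum_cong_neutral) (auto simp: delta_def)
    then show ?thesis
      by (simp add: green_def \<psi>_def delta_def)
  qed
  ultimately show ?thesis by simp
qed

section \<open>Decay of fractional moments\<close>

context bounded_density
begin

text \<open>Averaging over coordinate \<open>k\<close> first acts only on \<open>F\<close>, and
  almost every such conditional average is at most \<open>c\<close>.\<close>

lemma decouple:
  fixes F h :: "('i \<Rightarrow> real) \<Rightarrow> ennreal"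
  assumes F [measurable]: "F \<in> borel_measurable (\<Pi>\<^sub>M i\<in>UNIV. \<nu>)"
    and h [measurable]: "h \<in> borel_measurable (\<Pi>\<^sub>M i\<in>UNIV. \<nu>)"
    and c: "AE w in (\<Pi>\<^sub>M i\<in>UNIV. \<nu>). (\<integral>\<^sup>+ r. F (w(k := r)) \<partial>\<nu>) \<le> c"
    and upd: "\<And>w r. h (w(k := r)) = h w"
  shows "(\<integral>\<^sup>+ w. F w * h w \<partial>(\<Pi>\<^sub>M i\<in>UNIV. \<nu>)) \<le> c * (\<integral>\<^sup>+ w. h w \<partial>(\<Pi>\<^sub>M i\<in>UNIV. \<nu>))"
proof -
  let ?P = "\<Pi>\<^sub>M i\<in>UNIV. \<nu>"
  have sp: "space ?P = UNIV"
    using sets_eq_imp_space_eq[OF sets_eq] by (simp add: space_PiM)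
  have slice: "(\<lambda>r. F (w(k := r))) \<in> borel_measurable \<nu>" for w
  proof (rule measurable_compose[OF _ F])
    show "(\<lambda>r. w(k := r)) \<in> \<nu> \<rightarrow>\<^sub>M ?P"
      by (rule measurable_fun_upd[where J = UNIV]) (use sp in \<open>auto intro: measurable_const\<close>)
  qed
  have "(\<integral>\<^sup>+ w. F w * h w \<partial>?P) = (\<integral>\<^sup>+ w. (\<integral>\<^sup>+ r. F (w(k := r)) * h (w(k := r)) \<partial>\<nu>) \<partial>?P)"
    by (rule nn_integral_resample) measurable
  also have "\<dots> = (\<integral>\<^sup>+ w. (\<integral>\<^sup>+ r. F (w(k := r)) \<partial>\<nu>) * h w \<partial>?P)"
    unfolding upd by (intro nn_integral_cong nn_integral_multc slice)
  also have "\<dots> \<le> (\<integral>\<^sup>+ w. c * h w \<partial>?P)"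
  proof (rule nn_integral_mono_AE)
    show "AE w in ?P. (\<integral>\<^sup>+ r. F (w(k := r)) \<partial>\<nu>) * h w \<le> c * h w"
      using c by eventually_elim (rule mult_right_mono, auto)
  qed
  also have "\<dots> = c * (\<integral>\<^sup>+ w. h w \<partial>?P)"
    by (rule nn_integral_cmult) measurable
  finally show ?thesis .
qed

lemma AE_all_bounded:
  "AE w in (\<Pi>\<^sub>M i\<in>(UNIV :: 'i::countable set). \<nu>). \<forall>i. \<bar>w i\<bar> \<le> R\<^sub>0"
  unfolding AE_all_countable
  by (intro allI AE_PiM_component bounded UNIV_I prob_space_axioms)

end

context alloy
begin

lemma measurable_gf_symbol:
  assumes "finite \<Gamma>"
  shows "(\<lambda>w. lat.gf \<Gamma> (symbol g u w z) x y) \<in> borel_measurable P"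
proof (rule lat.measurable_gf[OF assms])
  note [measurable] = measurable_alloy_potential[OF finite_supp sets_eq]
  show "(\<lambda>w. symbol g u w z x) \<in> borel_measurable P" for x
    unfolding symbol_def by measurable
qed

definition gf_powr :: "real \<Rightarrow> real \<Rightarrow> complex \<Rightarrow> (int ^ 'd) set \<Rightarrow> int ^ 'd \<Rightarrow> int ^ 'd \<Rightarrow> (int ^ 'd \<Rightarrow> real) \<Rightarrow> ennreal" where
  "gf_powr \<tau> g z \<Gamma> x y w = ennreal (cmod (lat.gf \<Gamma> (symbol g u w z) x y) powr \<tau>)"

lemma measurable_gf_powr:
  assumes "finite \<Gamma>"
  shows "gf_powr \<tau> g z \<Gamma> x y \<in> borel_measurable P"
proof -
  note [measurable] = measurable_gf_symbol[OF assms]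
  show ?thesis unfolding gf_powr_def[abs_def] by measurable
qed

text \<open>The coupling at \<open>x\<close> acts on both \<open>x\<close> and \<open>v\<close>, as
  \<open>0\<close> and \<open>v - x\<close> lie in \<open>supp u\<close>, so its average controls
  this Green function.\<close>

lemma local_decoupling:
  assumes \<Gamma>: "finite \<Gamma>" and x: "x \<in> \<Gamma>" and v: "v \<in> \<Gamma>" "v - x \<in> supp u"
    and g: "1 \<le> g" and z: "Im z \<noteq> 0" and \<tau>: "0 < \<tau>" "real n * \<tau> < 1"
    and h: "h \<in> borel_measurable P" "\<And>w r. h (w(x := r)) = h w"
  shows "(\<integral>\<^sup>+ w. gf_powr \<tau> g z \<Gamma> x v w * h w \<partial>P) \<le>
    ennreal (moment_const \<tau> * g powr - \<tau>) * (\<integral>\<^sup>+ w. h w \<partial>P)"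
proof (rule decouple[OF measurable_gf_powr[OF \<Gamma>] h(1) _ h(2)])
  show "AE w in P. (\<integral>\<^sup>+ r. gf_powr \<tau> g z \<Gamma> x v (w(x := r)) \<partial>\<nu>) \<le> ennreal (moment_const \<tau> * g powr - \<tau>)"
    using AE_all_bounded
  proof eventually_elim
    case (elim w)
    then show ?case
      unfolding gf_powr_def using zero_in_supp
      by (intro conditional_moment_bound \<Gamma> x v g z \<tau>) auto
  qed
qed

text \<open>The greatest distance covered by one use of the resolvent expansion: from
  \<open>x\<close> to a site of its block, plus one hop.\<close>

definition R :: int where "R = Max (norm_max ` supp u) + 1"

lemma norm_max_less_R: "k \<in> supp u \<Longrightarrow> norm_max k < R"
  unfolding R_def using Max_ge[of "norm_max ` supp u" "norm_max k"] finite_supp by simp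

lemma R_pos: "0 < R"
  using norm_max_less_R[OF zero_in_supp] norm_max_nonneg[of "0 :: int ^ 'd"] by linarith

text \<open>Induction on the volume: each expansion removes the block of the current starting site,
  yields at most \<open>n * D\<close> terms with a factor \<open>c\<close> each, and uses up
  distance at most \<open>R\<close>. Strong disorder makes the total factor at most one
  half.\<close>

lemma finite_volume_decay:
  assumes g: "1 \<le> g" and z: "Im z \<noteq> 0" and \<tau>: "0 < \<tau>" "real n * \<tau> < 1"
    and c_def: "c = moment_const \<tau> * g powr - \<tau>" and small: "real n * real D * c \<le> 1 / 2"
    and "finite \<Gamma>" "x \<in> \<Gamma>" "y \<in> \<Gamma>" "int m * R \<le> norm_max (x - y)"
  shows "(\<integral>\<^sup>+ w. gf_powr \<tau> g z \<Gamma> x y w \<partial>P) \<le> ennreal (c * (1 / 2) ^ m)"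
  using assms(7-)
proof (induction \<Gamma> arbitrary: x m rule: finite_psubset_induct)
  case (psubset \<Gamma>)
  note x = \<open>x \<in> \<Gamma>\<close> and y = \<open>y \<in> \<Gamma>\<close> and \<Gamma> = \<open>finite \<Gamma>\<close>
  interpret P: prob_space P
    by (intro prob_space_PiM prob_space_axioms)
  have c0: "0 \<le> c"
    unfolding c_def using moment_const_ge_1[OF \<tau>(2)] by simp
  have "1 * \<tau> \<le> real n * \<tau>"
    using n_pos \<tau> by (intro mult_right_mono) auto
  then have \<tau>1: "\<tau> \<le> 1"
    using \<tau>(2) by linarith
  show ?case
  \<comment> \<open>If \<open>y\<close> lies in the block of \<open>x\<close>, the distance is below
    \<open>R\<close>, which forces \<open>m = 0\<close>, and one conditional average
    finishes.\<close>
  proof (cases "y - x \<in> supp u")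
    case True
    have "norm_max (x - y) < R"
      using norm_max_less_R[OF True] norm_max_minus[of "x - y"] by simp
    then have "int m * R < 1 * R"
      using psubset.prems by linarith
    then have "int m < 1"
      using R_pos by (simp only: mult_less_cancel_right_pos)
    then have "m = 0" by simp
    then show ?thesis
      using local_decoupling[OF \<Gamma> x y True g z \<tau>, of "\<lambda>_. 1"] by (simp add: c_def P.emeasure_space_1)
  next
    case False
    define \<Phi> where "\<Phi> = {v \<in> \<Gamma>. v - x \<in> supp u}"
    define \<Delta> where "\<Delta> = \<Gamma> - \<Phi>"
    define N where "N v = \<Delta> \<inter> {w. nb v w}" for v
    have \<Phi>: "\<Phi> \<subseteq> \<Gamma>" "x \<in> \<Phi>" and y': "y \<in> \<Delta>"
      using zero_in_supp x y False by (auto simp: \<Phi>_def \<Delta>_def)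
    have fin: "finite \<Phi>" "finite \<Delta>" "finite (N v)" for v
      using \<Gamma> by (auto simp: \<Phi>_def \<Delta>_def N_def)
    have cards: "card \<Phi> \<le> n" "card (N v) \<le> D" for v
    proof -
      show "card \<Phi> \<le> n"
        unfolding n_def by (rule card_inj_on_le[of "\<lambda>y. y - x"]) (auto simp: \<Phi>_def inj_on_def finite_supp)
      show "card (N v) \<le> D"
        using card_mono[OF lat.finite_nbrs[of v], of "N v"] lat.card_nbrs[of v] by (auto simp: N_def D_def)
    qed
    have pointwise: "gf_powr \<tau> g z \<Gamma> x y w \<le>
      (\<Sum>v\<in>\<Phi>. \<Sum>w'\<in>N v. gf_powr \<tau> g z \<Gamma> x v w * gf_powr \<tau> g z \<Delta> w' y w)" for w
    proof -
      let ?a = "symbol g u w z"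
      let ?t = "\<lambda>v w'. cmod (lat.gf \<Gamma> ?a x v) * cmod (lat.gf \<Delta> ?a w' y)"
      have "lat.gf \<Gamma> ?a x y = (\<Sum>v\<in>\<Phi>. lat.gf \<Gamma> ?a x v * (\<Sum>w'\<in>N v. lat.gf \<Delta> ?a w' y))"
        using lat.gf_resolvent_expansion[where a = ?a and e = "- Im z", OF \<Gamma> _ _ \<Phi>] y' z
        by (simp add: lat.hop_nbrs N_def \<Delta>_def \<Gamma>)
      then have "lat.gf \<Gamma> ?a x y = (\<Sum>v\<in>\<Phi>. \<Sum>w'\<in>N v. lat.gf \<Gamma> ?a x v * lat.gf \<Delta> ?a w' y)"
        by (simp add: sum_distrib_left)
      then have "cmod (lat.gf \<Gamma> ?a x y) \<le> (\<Sum>v\<in>\<Phi>. \<Sum>w'\<in>N v. ?t v w')"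
        by (simp only:) (rule sum_norm_le, rule sum_norm_le, simp add: norm_mult)
      then have "cmod (lat.gf \<Gamma> ?a x y) powr \<tau> \<le> (\<Sum>v\<in>\<Phi>. \<Sum>w'\<in>N v. ?t v w') powr \<tau>"
        using \<tau> by (intro powr_mono2) auto
      \<comment> \<open>Since \<open>\<tau> \<le> 1\<close>, the power is subadditive and passes
        inside both sums.\<close>
      also have "\<dots> \<le> (\<Sum>v\<in>\<Phi>. (\<Sum>w'\<in>N v. ?t v w') powr \<tau>)"
        using \<tau>(1) \<tau>1 by (rule powr_sum_le[rotated]) (simp add: sum_nonneg)
      also have "\<dots> \<le> (\<Sum>v\<in>\<Phi>. \<Sum>w'\<in>N v. ?t v w' powr \<tau>)"
      proof (rule sum_mono)
        fix v
        show "(\<Sum>w'\<in>N v. ?t v w') powr \<tau> \<le> (\<Sum>w'\<in>N v. ?t v w' powr \<tau>)"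
          using \<tau>(1) \<tau>1 by (rule powr_sum_le[rotated]) simp
      qed
      finally have "ennreal (cmod (lat.gf \<Gamma> ?a x y) powr \<tau>) \<le>
          ennreal (\<Sum>v\<in>\<Phi>. \<Sum>w'\<in>N v. ?t v w' powr \<tau>)"
        by (rule ennreal_leI)
      also have "\<dots> = (\<Sum>v\<in>\<Phi>. \<Sum>w'\<in>N v. ennreal (?t v w' powr \<tau>))"
        by (simp add: sum_nonneg flip: sum_ennreal)
      finally show ?thesis
        by (simp add: gf_powr_def powr_mult ennreal_mult)
    qed
    \<comment> \<open>No site of \<open>\<Delta>\<close> feels the coupling at \<open>x\<close>, so
      this factor stays fixed during the average over that coupling.\<close>
    have indep: "gf_powr \<tau> g z \<Delta> w' y (w(x := r)) = gf_powr \<tau> g z \<Delta> w' y w" for w' w r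
    proof -
      have "symbol g u (w(x := r)) z v = symbol g u w z v" if "v \<in> \<Delta>" for v
      proof -
        have "u (v - x) = 0"
          using that by (auto simp: \<Delta>_def \<Phi>_def supp_def)
        then have "alloy_potential u (w(x := r)) v = alloy_potential u (w(x := w x)) v"
          using alloy_potential_update[OF finite_supp, of w x r v] alloy_potential_update[OF finite_supp, of w x "w x" v] by simp
        then show ?thesis by (simp add: symbol_def)
      qed
      then show ?thesis
        unfolding gf_powr_def using lat.gf_cong[OF fin(2)] by metis
    qed
    have step: "(\<integral>\<^sup>+ w. gf_powr \<tau> g z \<Gamma> x v w * gf_powr \<tau> g z \<Delta> w' y w \<partial>P) \<le> ennreal (c * (c * (1 / 2) ^ (m - 1)))"
      if v: "v \<in> \<Phi>" and w': "w' \<in> N v" for v w'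
    proof -
      have "norm_max (v - x) \<le> R - 1" "norm_max (w' - v) \<le> 1"
        using v w' norm_max_less_R[of "v - x"] norm_max_le_norm_one[of "w' - v"] norm_one_minus[of "v - w'"]
        by (auto simp: \<Phi>_def N_def nb_def)
      moreover have "norm_max (x - y) \<le> norm_max (x - w') + norm_max (w' - y)"
        using norm_max_triangle[of "x - w'" "w' - y"] by simp
      moreover have "norm_max (x - w') \<le> norm_max (v - x) + norm_max (w' - v)"
        using norm_max_triangle[of "v - x" "w' - v"] norm_max_minus[of "x - w'"] by simp
      ultimately have "int m * R - R \<le> norm_max (w' - y)"
        using psubset.prems by linarith
      \<comment> \<open>For \<open>m = 0\<close> the truncated subtraction gives \<open>0\<close> on
        the left and the claim is nonnegativity of the norm.\<close>
      then have "int (m - 1) * R \<le> norm_max (w' - y)"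
        using norm_max_nonneg[of "w' - y"] by (cases m) (auto simp: algebra_simps)
      then have IH: "(\<integral>\<^sup>+ w. gf_powr \<tau> g z \<Delta> w' y w \<partial>P) \<le> ennreal (c * (1 / 2) ^ (m - 1))"
        using w' y' \<Phi> x by (intro psubset.IH) (auto simp: \<Delta>_def N_def)
      have "(\<integral>\<^sup>+ w. gf_powr \<tau> g z \<Gamma> x v w * gf_powr \<tau> g z \<Delta> w' y w \<partial>P) \<le>
          ennreal c * (\<integral>\<^sup>+ w. gf_powr \<tau> g z \<Delta> w' y w \<partial>P)"
        unfolding c_def using v
        by (intro local_decoupling \<Gamma> x g z \<tau> measurable_gf_powr fin indep) (auto simp: \<Phi>_def)
      also have "\<dots> \<le> ennreal c * ennreal (c * (1 / 2) ^ (m - 1))"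
        using IH by (rule mult_left_mono) simp
      also have "\<dots> = ennreal (c * (c * (1 / 2) ^ (m - 1)))"
        using c0 by (simp add: ennreal_mult')
      finally show ?thesis .
    qed
    have "(\<integral>\<^sup>+ w. gf_powr \<tau> g z \<Gamma> x y w \<partial>P) \<le>
        (\<integral>\<^sup>+ w. (\<Sum>v\<in>\<Phi>. \<Sum>w'\<in>N v. gf_powr \<tau> g z \<Gamma> x v w * gf_powr \<tau> g z \<Delta> w' y w) \<partial>P)"
      by (intro nn_integral_mono pointwise)
    also have "\<dots> = (\<Sum>v\<in>\<Phi>. \<Sum>w'\<in>N v. \<integral>\<^sup>+ w. gf_powr \<tau> g z \<Gamma> x v w * gf_powr \<tau> g z \<Delta> w' y w \<partial>P)"
    proof -
      note [measurable] = measurable_gf_powr[OF \<Gamma>] measurable_gf_powr[OF fin(2)]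
      have "(\<integral>\<^sup>+ w. (\<Sum>v\<in>\<Phi>. \<Sum>w'\<in>N v. gf_powr \<tau> g z \<Gamma> x v w * gf_powr \<tau> g z \<Delta> w' y w) \<partial>P) =
          (\<Sum>v\<in>\<Phi>. \<integral>\<^sup>+ w. (\<Sum>w'\<in>N v. gf_powr \<tau> g z \<Gamma> x v w * gf_powr \<tau> g z \<Delta> w' y w) \<partial>P)"
        by (rule nn_integral_sum) measurable
      also have "\<dots> = (\<Sum>v\<in>\<Phi>. \<Sum>w'\<in>N v. \<integral>\<^sup>+ w. gf_powr \<tau> g z \<Gamma> x v w * gf_powr \<tau> g z \<Delta> w' y w \<partial>P)"
        by (intro sum.cong refl nn_integral_sum) measurable
      finally show ?thesis .
    qed
    also have "\<dots> \<le> (\<Sum>v\<in>\<Phi>. \<Sum>w'\<in>N v. ennreal (c * (c * (1 / 2) ^ (m - 1))))"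
      by (intro sum_mono step)
    also have "\<dots> = ennreal (\<Sum>v\<in>\<Phi>. \<Sum>w'\<in>N v. c * (c * (1 / 2) ^ (m - 1)))"
      using c0 by (simp only: sum_ennreal mult_nonneg_nonneg sum_nonneg zero_le_power)
    also have "\<dots> \<le> ennreal (c * (1 / 2) ^ m)"
    proof (rule ennreal_leI)
      have "(\<Sum>v\<in>\<Phi>. \<Sum>w'\<in>N v. c * (c * (1 / 2) ^ (m - 1))) \<le> (\<Sum>v\<in>\<Phi>. real D * (c * (c * (1 / 2) ^ (m - 1))))"
        using c0 cards by (intro sum_mono) (auto intro!: mult_right_mono)
      also have "\<dots> \<le> real n * (real D * (c * (c * (1 / 2) ^ (m - 1))))"
        using c0 cards by (auto intro!: mult_right_mono)
      also have "\<dots> = (real n * real D * c) * (c * (1 / 2) ^ (m - 1))"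
        by (simp add: algebra_simps)
      also have "\<dots> \<le> 1 / 2 * (c * (1 / 2) ^ (m - 1))"
        using small c0 by (intro mult_right_mono) auto
      also have "\<dots> \<le> c * (1 / 2) ^ m"
        using c0 by (cases m) auto
      finally show "(\<Sum>v\<in>\<Phi>. \<Sum>w'\<in>N v. c * (c * (1 / 2) ^ (m - 1))) \<le> c * (1 / 2) ^ m" .
    qed
    finally show ?thesis .
  qed
qed

end

section \<open>Infinite-volume decay and the strong disorder regime\<close>

context alloy
begin

text \<open>Fatou's lemma carries the finite-volume bound to the limit, as truncations eventually
  contain both sites. The factor \<open>2\<close> absorbs the rounding in \<open>m\<close>.\<close>

lemma green_moment_decay:
  fixes \<Gamma> :: "(int ^ 'd) set"
  assumes g: "1 \<le> g" and z: "Im z \<noteq> 0" and \<tau>: "0 < \<tau>" "real n * \<tau> < 1"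
    and c_def: "c = moment_const \<tau> * g powr - \<tau>" and small: "real n * real D * c \<le> 1 / 2"
    and x: "x \<in> \<Gamma>" and y: "y \<in> \<Gamma>"
  shows "(\<integral>\<^sup>+ w. ennreal (cmod (green g u w \<Gamma> z x y) powr \<tau>) \<partial>P) \<le>
    ennreal (2 * c * exp (- (ln 2 / of_int R) * of_int (norm_max (x - y))))"
proof -
  have c0: "0 \<le> c"
    unfolding c_def using moment_const_ge_1[OF \<tau>(2)] by simp
  \<comment> \<open>The number of complete steps of length \<open>R\<close> between the two
    sites.\<close>
  define m where "m = nat (norm_max (x - y) div R)"
  have m: "int m = norm_max (x - y) div R"
    unfolding m_def using norm_max_nonneg[of "x - y"] R_pos by (simp add: pos_imp_zdiv_nonneg_iff)
  have div: "norm_max (x - y) = int m * R + norm_max (x - y) mod R"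
    unfolding m by (rule div_mult_mod_eq[symmetric])
  have "int m * R \<le> norm_max (x - y)"
    using div pos_mod_sign[OF R_pos, of "norm_max (x - y)"] by linarith
  then have finite_bound: "(\<integral>\<^sup>+ w. gf_powr \<tau> g z (truncation \<Gamma> N) x y w \<partial>P) \<le> ennreal (c * (1 / 2) ^ m)"
    if "x \<in> truncation \<Gamma> N" "y \<in> truncation \<Gamma> N" for N
    using that by (intro finite_volume_decay[OF g z \<tau> c_def small finite_truncation])
  have "(\<integral>\<^sup>+ w. ennreal (cmod (green g u w \<Gamma> z x y) powr \<tau>) \<partial>P) =
      (\<integral>\<^sup>+ w. liminf (\<lambda>N. gf_powr \<tau> g z (truncation \<Gamma> N) x y w) \<partial>P)"
  proof (rule nn_integral_cong)
    fix w
    have "(\<lambda>N. gf_powr \<tau> g z (truncation \<Gamma> N) x y w) \<longlonglongrightarrow> ennreal (cmod (green g u w \<Gamma> z x y) powr \<tau>)"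
      unfolding gf_powr_def using \<tau>(1)
      by (intro tendsto_ennrealI tendsto_powr' tendsto_norm tendsto_const green_eq_limit z x y) auto
    then show "ennreal (cmod (green g u w \<Gamma> z x y) powr \<tau>) = liminf (\<lambda>N. gf_powr \<tau> g z (truncation \<Gamma> N) x y w)"
      by (intro lim_imp_Liminf[symmetric]) auto
  qed
  also have "\<dots> \<le> liminf (\<lambda>N. \<integral>\<^sup>+ w. gf_powr \<tau> g z (truncation \<Gamma> N) x y w \<partial>P)"
    by (intro nn_integral_liminf measurable_gf_powr finite_truncation)
  also have "\<dots> \<le> limsup (\<lambda>N. \<integral>\<^sup>+ w. gf_powr \<tau> g z (truncation \<Gamma> N) x y w \<partial>P)"
    by (rule Liminf_le_Limsup) simp
  also have "\<dots> \<le> ennreal (c * (1 / 2) ^ m)"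
  proof (rule Limsup_bounded)
    show "\<forall>\<^sub>F N in sequentially. (\<integral>\<^sup>+ w. gf_powr \<tau> g z (truncation \<Gamma> N) x y w \<partial>P) \<le> ennreal (c * (1 / 2) ^ m)"
      using eventually_truncation[OF x] eventually_truncation[OF y]
      by eventually_elim (rule finite_bound)
  qed
  also have "\<dots> \<le> ennreal (2 * c * exp (- (ln 2 / of_int R) * of_int (norm_max (x - y))))"
  proof (rule ennreal_leI)
    have "norm_max (x - y) < (int m + 1) * R"
      using div pos_mod_bound[OF R_pos, of "norm_max (x - y)"] by (simp add: distrib_right)
    then have "real_of_int (norm_max (x - y)) \<le> of_int ((int m + 1) * R)"
      by (simp only: of_int_le_iff)
    then have "real_of_int (norm_max (x - y)) / of_int R \<le> real m + 1"
      using R_pos by (simp add: pos_divide_le_eq)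
    then have "ln 2 * (real_of_int (norm_max (x - y)) / of_int R) \<le> ln 2 * (real m + 1)"
      by (intro mult_left_mono) auto
    then have "exp (- (ln 2 * (real m + 1))) \<le> exp (- (ln 2 / of_int R) * of_int (norm_max (x - y)))"
      by simp
    moreover have "exp (- (ln 2 * (real m + 1))) = (1 / 2) ^ (m + 1)"
    proof -
      have "exp (- (ln 2 * (real m + 1))) = exp (- ln 2) ^ (m + 1)"
        by (simp add: exp_of_nat_mult[symmetric] algebra_simps flip: exp_add)
      then show ?thesis by (simp add: exp_minus inverse_eq_divide)
    qed
    ultimately have "(1 / 2 :: real) ^ m \<le> 2 * exp (- (ln 2 / of_int R) * of_int (norm_max (x - y)))"
      by simp
    from mult_left_mono[OF this c0]
    show "c * (1 / 2) ^ m \<le> 2 * c * exp (- (ln 2 / of_int R) * of_int (norm_max (x - y)))"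
      by (simp only: mult_ac)
  qed
  finally show ?thesis .
qed

text \<open>\<open>moment_const \<tau>\<close> does not depend on \<open>g\<close>, so the product
  decays like \<open>g powr - \<tau>\<close>.\<close>

lemma eventually_strong_disorder:
  assumes \<tau>: "0 < \<tau>"
  shows "\<forall>\<^sub>F g in at_top. 1 \<le> g \<and> real n * real D * (moment_const \<tau> * g powr - \<tau>) \<le> 1 / 2"
proof (intro eventually_conj eventually_ge_at_top)
  have "((\<lambda>g. real n * real D * (moment_const \<tau> * g powr - \<tau>)) \<longlongrightarrow> real n * real D * (moment_const \<tau> * 0)) at_top"
    using \<tau> by (intro tendsto_intros tendsto_neg_powr filterlim_ident) auto
  then have "\<forall>\<^sub>F g in at_top. real n * real D * (moment_const \<tau> * g powr - \<tau>) < 1 / 2"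
    by (rule order_tendstoD) simp
  then show "\<forall>\<^sub>F g in at_top. real n * real D * (moment_const \<tau> * g powr - \<tau>) \<le> 1 / 2"
    by eventually_elim simp
qed

end

section \<open>From the essential supremum of the density to the theorem\<close>

lemma bounded_density_of_esssup:
  fixes \<nu> :: "real measure" and \<rho> :: "real \<Rightarrow> real"
  assumes prob: "prob_space \<nu>" and cpt: "compact (measure_support \<nu>)"
    and \<rho>: "\<rho> \<in> borel_measurable borel" and sup: "esssup lborel (\<lambda>t. ereal \<bar>\<rho> t\<bar>) < \<infinity>"
    and \<nu>: "\<nu> = density lborel (\<lambda>t. ennreal (\<rho> t))"
  shows "\<exists>C R. bounded_density \<nu> C R"
proof -
  have sets: "sets \<nu> = sets borel"
    unfolding \<nu> by simp
  obtain R where R: "AE t in \<nu>. \<bar>t\<bar> \<le> R"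
    using compact_support_bounded[OF cpt sets] by blast
  obtain C :: nat where C: "esssup lborel (\<lambda>t. ereal \<bar>\<rho> t\<bar>) \<le> ereal (real C)"
    using sup less_imp_le[of "esssup lborel (\<lambda>t. ereal \<bar>\<rho> t\<bar>)"]
    by (auto simp: less_PInf_Ex_of_nat[of "esssup lborel (\<lambda>t. ereal \<bar>\<rho> t\<bar>)"])
  have "AE t in lborel. ereal \<bar>\<rho> t\<bar> \<le> esssup lborel (\<lambda>t. ereal \<bar>\<rho> t\<bar>)"
    by (rule esssup_AE)
  then have le: "AE t in lborel. \<rho> t \<le> real C"
  proof eventually_elim
    case (elim t)
    then have "ereal \<bar>\<rho> t\<bar> \<le> ereal (real C)"
      using C by (rule order_trans)
    then show ?case by simp
  qed
  have "bounded_density \<nu> (real C) R"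
  proof (intro bounded_density.intro prob bounded_density_axioms.intro sets R)
    fix f :: "real \<Rightarrow> ennreal" assume f: "f \<in> borel_measurable borel"
    have "(\<integral>\<^sup>+ t. f t \<partial>\<nu>) = (\<integral>\<^sup>+ t. ennreal (\<rho> t) * f t \<partial>lborel)"
      unfolding \<nu> using \<rho> f by (subst nn_integral_density) auto
    also have "\<dots> \<le> (\<integral>\<^sup>+ t. ennreal (real C) * f t \<partial>lborel)"
    proof (rule nn_integral_mono_AE)
      show "AE t in lborel. ennreal (\<rho> t) * f t \<le> ennreal (real C) * f t"
        using le by eventually_elim (intro mult_right_mono ennreal_leI, auto)
    qed
    also have "\<dots> = ennreal (real C) * (\<integral>\<^sup>+ t. f t \<partial>lborel)"
      using f by (intro nn_integral_cmult) auto
    finally show "(\<integral>\<^sup>+ t. f t \<partial>\<nu>) \<le> ennreal (real C) * (\<integral>\<^sup>+ t. f t \<partial>lborel)" .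
  qed simp
  then show ?thesis by blast
qed

theorem theorem2p3:
  fixes u :: "int ^ 'd \<Rightarrow> real" and \<nu> :: "real measure" and \<rho> :: "real \<Rightarrow> real" and s :: real
  assumes "prob_space \<nu>"
    and "compact (measure_support \<nu>)"
    and "\<rho> \<in> borel_measurable borel"
    and "AE t in lborel. 0 \<le> \<rho> t"
    and "esssup lborel (\<lambda>t. ereal \<bar>\<rho> t\<bar>) < \<infinity>"
    and "\<nu> = density lborel (\<lambda>t. ennreal (\<rho> t))"
    and "(\<lambda>k. \<bar>u k\<bar>) summable_on UNIV"
    and "0 \<in> supp u"
    and "finite (supp u)"
    and "\<forall>k \<in> interior_boundary (supp u). u k > 0"
    and "0 < s" and "s < 1 / 3"
  shows "\<forall>\<^sub>F g in at_top. \<exists>\<mu>>0. \<exists>A>0. \<forall>\<Gamma> :: (int ^ 'd) set.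
           \<forall>z. z \<notin> \<real> \<longrightarrow> (\<forall>x\<in>\<Gamma>. \<forall>y\<in>\<Gamma>.
             (\<integral>\<^sup>+ \<omega>. ennreal (cmod (green g u \<omega> \<Gamma> z x y) powr (s / (2 * real (card (supp u)))))
                \<partial>(\<Pi>\<^sub>M k\<in>(UNIV :: (int ^ 'd) set). \<nu>))
             \<le> ennreal (A * exp (- \<mu> * of_int (norm_max (x - y)))))"
proof -
  obtain C B where "bounded_density \<nu> C B"
    using bounded_density_of_esssup[OF assms(1-3,5,6)] by blast
  then interpret alloy \<nu> C B u
    using assms(8-10) by (intro alloy.intro alloy_axioms.intro)
  define \<tau> where "\<tau> = s / (2 * real (card (supp u)))"
  \<comment> \<open>Here \<open>n * \<tau>\<close> equals \<open>s / 2\<close>, so the singularities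
    of order \<open>n * \<tau>\<close> are integrable.\<close>
  have \<tau>: "0 < \<tau>" "real n * \<tau> < 1"
    using n_pos assms(11,12) by (auto simp: \<tau>_def n_def)
  show ?thesis
    unfolding \<tau>_def[symmetric] using eventually_strong_disorder[OF \<tau>(1)]
  proof eventually_elim
    case (elim g)
    let ?c = "moment_const \<tau> * g powr - \<tau>"
    show ?case
    \<comment> \<open>The rate is a halving per distance \<open>R\<close>, and the amplitude is
      twice the one-step factor; both are fixed before volume, energy and sites.\<close>
    proof (rule exI[of _ "ln 2 / real_of_int R"], rule conjI, goal_cases)
      case 1
      show ?case
        using R_pos by simp
    next
      case 2
      show ?case
      proof (rule exI[of _ "2 * ?c"], intro conjI allI impI ballI)
        show "0 < 2 * ?c"
          using moment_const_ge_1[OF \<tau>(2)] elim by simp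
        fix \<Gamma> :: "(int ^ 'd) set" and z :: complex and x y
        assume "z \<notin> \<real>" "x \<in> \<Gamma>" "y \<in> \<Gamma>"
        then show "(\<integral>\<^sup>+ \<omega>. ennreal (cmod (green g u \<omega> \<Gamma> z x y) powr \<tau>) \<partial>P)
            \<le> ennreal (2 * ?c * exp (- (ln 2 / of_int R) * of_int (norm_max (x - y))))"
          using elim by (intro green_moment_decay \<tau>) (auto simp: complex_is_Real_iff)
      qed
    qed
  qed
qed

end
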